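(* Let $X,Y$ be coverable uniform spaces with universal covers $\phi:\widetilde{X}\to X$ and $\psi:\widetilde{Y}\to Y$. If $f:X\to Y$ is uniformly continuous and basepoint-preserving, then there is a unique uniformly continuous basepoint-preserving function $\widetilde{f}:\widetilde{X}\to\widetilde{Y}$ such that $f\circ\phi=\psi\circ\widetilde{f}$. Moreover: (1) If $f$ is a cover then $\widetilde{f}$ is a uniform homeomorphism. (2) If $Z$ is a coverable uniform space and $g:Y\to Z$ is uniformly continuous and basepoint-preserving, then $\widetilde{g\circ f}=\widetilde{g}\circ\widetilde{f}$.
   Context: All entourages are taken to be symmetric; $B(x,E)=\{y:(x,y)\in E\}$. Each space has a fixed basepoint $*$. For an entourage $E$ of a uniform space $X$, an $E$-chain from $p$ to $q$ is a finite sequence $\{x_0=p,\dots,x_n=q\}$ with $(x_i,x_{i+1})\in E$ for all $i$. Two $E$-chains with the same endpoints are $E$-homotopic if one is obtained from the other in finitely many steps, each adding or removing a single point, always keeping the endpoints fixed and keeping an $E$-chain at each stage (in particular $\{p\}$ and $\{p,p\}$ are $E$-homotopic); $[\alpha]_E$ is the class of $\alpha$. $X_E$ is the set of $E$-homotopy classes of $E$-chains starting at $*$, with basepoint $[*]_E$. For an entourage $D\subset E$ let $D^*$ be the set of pairs $([*=x_0,\dots,x_n,y]_E,[*=x_0,\dots,x_n,z]_E)$ with $(y,z)\in D$; $X_E$ carries the uniformity with base $\{D^*:D\subset E\}$. The endpoint map is $\phi_{XE}:X_E\to X$, and for $D\subset E$, $\phi_{ED}:X_D\to X_E$ is $[\alpha]_D\mapsto[\alpha]_E$.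 $\widetilde{X}=\varprojlim X_E$ (over all entourages, ordered by reverse inclusion, with the inverse limit uniformity and basepoint $([*]_E)_E$), with projections $\phi_E:\widetilde{X}\to X_E$ and $\phi:\widetilde{X}\to X=X_{X\times X}$. $X$ is coverable if its uniformity has a base, containing $X\times X$, of entourages $E$ for which $\phi_E$ is surjective; then $\phi:\widetilde X\to X$ is called the universal cover of $X$. Group actions and covers. A group $G$ acting on a uniform space $X$ by uniform homeomorphisms acts isomorphically if the uniformity of $X$ has a base of entourages $E$ with $(g\times g)(E)=E$ for all $g\in G$; it acts discretely if there is an entourage $E$ such that $(g(x),x)\in E$ for some $x\in X$ implies $g=1$; it acts prodiscretely if the action is an inverse limit of discrete actions, i.e. $X=\varprojlim X_\alpha$ (with the inverse limit uniformity, projections surjective), $G=\varprojlim G_\alpha$ over the same directed set, each $G_\alpha$ acts discretely on $X_\alpha$ by uniform homeomorphisms, the bonding maps $X_\beta\to X_\alpha$ (uniformly continuous) are equivariant with respect to the bonding homomorphisms $G_\beta\to G_\alpha$, and $G$ acts coordinatewise. $X/G$ carries the quotient uniformity, with base the images of entourages of $X$. A cover is a map which, up to uniform homeomorphism of the target, is the quotient map $X\to X/G$ of a prodiscrete isomorphic action; $G$ is its covering group. *)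

theory Defs
  imports Complex_Main "HOL-Algebra.Group_Action" "HOL-Algebra.Product_Groups"
begin

section \<open>Uniform spaces with an explicit carrier\<close>

text \<open>
  The spaces of chain classes and their inverse limits depend on entourages, hence cannot be
  instances of the type class \<open>uniform_space\<close>.  We use the axioms of that class, relative to a
  carrier; the uniformity is a filter concentrated on pairs of points of the carrier.
  No separation axiom is imposed.
\<close>

record 'a uspace = "'a partial_object" +
  unif :: "('a \<times> 'a) filter"

definition uspace :: "'a uspace \<Rightarrow> bool" where
  "uspace X \<longleftrightarrow>
     unif X \<le> principal (carrier X \<times> carrier X) \<and>
     (\<forall>E. eventually E (unif X) \<longrightarrow> (\<forall>x\<in>carrier X. E (x, x))) \<and>
     (\<forall>E. eventually E (unif X) \<longrightarrow> eventually (\<lambda>(x, y). E (y, x)) (unif X)) \<and>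
     (\<forall>E. eventually E (unif X) \<longrightarrow>
        (\<exists>D. eventually D (unif X) \<and> (\<forall>x y z. D (x, y) \<longrightarrow> D (y, z) \<longrightarrow> E (x, z))))"

text \<open>Entourages are symmetric by convention.\<close>

definition entourages :: "'a uspace \<Rightarrow> ('a \<times> 'a) set set" where
  "entourages X = {E. E \<subseteq> carrier X \<times> carrier X \<and> sym E \<and> eventually (\<lambda>p. p \<in> E) (unif X)}"

definition ucont :: "'a uspace \<Rightarrow> 'b uspace \<Rightarrow> ('a \<Rightarrow> 'b) \<Rightarrow> bool" where
  "ucont X Y f \<longleftrightarrow> f \<in> carrier X \<rightarrow> carrier Y \<and> filterlim (map_prod f f) (unif Y) (unif X)"

definition uhomeo :: "'a uspace \<Rightarrow> 'b uspace \<Rightarrow> ('a \<Rightarrow> 'b) \<Rightarrow> bool" where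
  "uhomeo X Y f \<longleftrightarrow> bij_betw f (carrier X) (carrier Y) \<and> ucont X Y f \<and>
     ucont Y X (inv_into (carrier X) f)"

definition is_base :: "'a uspace \<Rightarrow> ('a \<times> 'a) set set \<Rightarrow> bool" where
  "is_base X B \<longleftrightarrow> B \<subseteq> entourages X \<and> (\<forall>E\<in>entourages X. \<exists>D\<in>B. D \<subseteq> E)"

lemma uspace_uniformity_on:
  "uspace \<lparr>carrier = S, unif = uniformity_on (S :: 'a::uniform_space set)\<rparr>"
  unfolding uspace_def
proof (intro conjI allI impI; simp add: eventually_inf_principal)
  fix E :: "'a \<times> 'a \<Rightarrow> bool"
  assume E: "\<forall>\<^sub>F p in uniformity. p \<in> S \<times> S \<longrightarrow> E p"
  show "\<forall>x\<in>S. E (x, x)"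
    using uniformity_refl[OF E] by auto
  show "\<forall>\<^sub>F p in uniformity. p \<in> S \<times> S \<longrightarrow> (case p of (x, y) \<Rightarrow> E (y, x))"
    using uniformity_sym[OF E] by (rule eventually_mono) auto
  obtain D where D: "eventually D uniformity"
      "\<And>x y z. D (x, y) \<Longrightarrow> D (y, z) \<Longrightarrow> (x, z) \<in> S \<times> S \<longrightarrow> E (x, z)"
    using uniformity_trans[OF E] by blast
  let ?D = "\<lambda>p. p \<in> S \<times> S \<and> D p"
  have "\<forall>\<^sub>F p in uniformity. p \<in> S \<times> S \<longrightarrow> ?D p"
    using D(1) by (rule eventually_mono) auto
  moreover have "\<forall>x y z. ?D (x, y) \<longrightarrow> ?D (y, z) \<longrightarrow> E (x, z)"
    using D(2) by blast
  ultimately show "\<exists>D. (\<forall>\<^sub>F p in uniformity. p \<in> S \<times> S \<longrightarrow> D p) \<and>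
      (\<forall>x y. D (x, y) \<longrightarrow> (\<forall>z. D (y, z) \<longrightarrow> E (x, z)))"
    by (intro exI[of _ ?D]) blast
qed

lemma ucont_iff_uniformly_continuous_on:
  "ucont \<lparr>carrier = S, unif = uniformity_on S\<rparr> \<lparr>carrier = UNIV, unif = uniformity\<rparr> f
     \<longleftrightarrow> uniformly_continuous_on S f"
  by (simp add: ucont_def uniformly_continuous_on_uniformity map_prod_def)


section \<open>Inverse systems\<close>

text \<open>
  \<open>I\<close> is a directed set under the preorder \<open>leq\<close>, and for \<open>leq i j\<close> the bonding map \<open>b i j\<close> goes from
  the \<open>j\<close>-th to the \<open>i\<close>-th object.
\<close>

definition directed :: "'i set \<Rightarrow> ('i \<Rightarrow> 'i \<Rightarrow> bool) \<Rightarrow> bool" where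
  "directed I leq \<longleftrightarrow> I \<noteq> {} \<and> (\<forall>i\<in>I. leq i i) \<and>
     (\<forall>i\<in>I. \<forall>j\<in>I. \<forall>k\<in>I. leq i j \<longrightarrow> leq j k \<longrightarrow> leq i k) \<and>
     (\<forall>i\<in>I. \<forall>j\<in>I. \<exists>k\<in>I. leq i k \<and> leq j k)"

definition functorial ::
  "'i set \<Rightarrow> ('i \<Rightarrow> 'i \<Rightarrow> bool) \<Rightarrow> ('i \<Rightarrow> 'b set) \<Rightarrow> ('i \<Rightarrow> 'i \<Rightarrow> 'b \<Rightarrow> 'b) \<Rightarrow> bool" where
  "functorial I leq A b \<longleftrightarrow> (\<forall>i\<in>I. \<forall>x\<in>A i. b i i x = x) \<and>
     (\<forall>i\<in>I. \<forall>j\<in>I. \<forall>k\<in>I. leq i j \<longrightarrow> leq j k \<longrightarrow> (\<forall>x\<in>A k. b i j (b j k x) = b i k x))"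

definition lim_set ::
  "'i set \<Rightarrow> ('i \<Rightarrow> 'i \<Rightarrow> bool) \<Rightarrow> ('i \<Rightarrow> 'b set) \<Rightarrow> ('i \<Rightarrow> 'i \<Rightarrow> 'b \<Rightarrow> 'b) \<Rightarrow> ('i \<Rightarrow> 'b) set" where
  "lim_set I leq A b = {x \<in> (\<Pi>\<^sub>E i\<in>I. A i). \<forall>i\<in>I. \<forall>j\<in>I. leq i j \<longrightarrow> b i j (x j) = x i}"

text \<open>The inverse limit uniformity is the coarsest one making all projections uniformly continuous.\<close>

definition lim_space ::
  "'i set \<Rightarrow> ('i \<Rightarrow> 'i \<Rightarrow> bool) \<Rightarrow> ('i \<Rightarrow> 'b uspace) \<Rightarrow> ('i \<Rightarrow> 'i \<Rightarrow> 'b \<Rightarrow> 'b) \<Rightarrow> ('i \<Rightarrow> 'b) uspace" where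
  "lim_space I leq X b =
     (let L = lim_set I leq (\<lambda>i. carrier (X i)) b in
      \<lparr>carrier = L,
       unif = inf (INF i\<in>I. filtercomap (\<lambda>(x, y). (x i, y i)) (unif (X i))) (principal (L \<times> L))\<rparr>)"

definition lim_group ::
  "'i set \<Rightarrow> ('i \<Rightarrow> 'i \<Rightarrow> bool) \<Rightarrow> ('i \<Rightarrow> 'h monoid) \<Rightarrow> ('i \<Rightarrow> 'i \<Rightarrow> 'h \<Rightarrow> 'h) \<Rightarrow> ('i \<Rightarrow> 'h) monoid" where
  "lim_group I leq G b = (product_group I G) \<lparr>carrier := lim_set I leq (\<lambda>i. carrier (G i)) b\<rparr>"


section \<open>Chains and their homotopy classes\<close>

text \<open>Chains are nonempty lists.  All sets \<open>E\<close> below are subsets of \<open>carrier X \<times> carrier X\<close>.\<close>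

definition chain :: "('a \<times> 'a) set \<Rightarrow> 'a list \<Rightarrow> bool" where
  "chain E xs \<longleftrightarrow> xs \<noteq> [] \<and> successively (\<lambda>x y. (x, y) \<in> E) xs"

definition chains_from :: "'a \<Rightarrow> ('a \<times> 'a) set \<Rightarrow> 'a list set" where
  "chains_from x0 E = {xs. chain E xs \<and> hd xs = x0}"

text \<open>Adding a single point to an \<open>E\<close>-chain, with the endpoints kept fixed.\<close>

definition insert_step :: "('a \<times> 'a) set \<Rightarrow> 'a list rel" where
  "insert_step E = {(xs @ ys, xs @ y # ys) | xs y ys.
     chain E (xs @ ys) \<and> chain E (xs @ y # ys) \<and>
     hd (xs @ ys) = hd (xs @ y # ys) \<and> last (xs @ ys) = last (xs @ y # ys)}"

definition homotopic :: "('a \<times> 'a) set \<Rightarrow> 'a list rel" where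
  "homotopic E = (insert_step E \<union> (insert_step E)\<inverse>)\<^sup>*"

definition chain_class :: "('a \<times> 'a) set \<Rightarrow> 'a list \<Rightarrow> 'a list set" where
  "chain_class E xs = homotopic E `` {xs}"

definition star :: "'a \<Rightarrow> ('a \<times> 'a) set \<Rightarrow> ('a \<times> 'a) set \<Rightarrow> ('a list set \<times> 'a list set) set" where
  "star x0 E D = {(chain_class E (xs @ [y]), chain_class E (xs @ [z])) | xs y z.
     xs \<noteq> [] \<and> xs @ [y] \<in> chains_from x0 E \<and> xs @ [z] \<in> chains_from x0 E \<and> (y, z) \<in> D}"

text \<open>The space $X_E$.\<close>

definition chain_space :: "'a uspace \<Rightarrow> 'a \<Rightarrow> ('a \<times> 'a) set \<Rightarrow> 'a list set uspace" where
  "chain_space X x0 E =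
     \<lparr>carrier = chains_from x0 E // homotopic E,
      unif = (INF D\<in>{D \<in> entourages X. D \<subseteq> E}. principal (star x0 E D))\<rparr>"

text \<open>The endpoint map $X_E \to X$, and the map $X_D \to X_E$ for $D \subseteq E$; both images
  are singletons.\<close>

definition endpoint :: "'a list set \<Rightarrow> 'a" where
  "endpoint c = the_elem (last ` c)"

definition coarsen :: "('a \<times> 'a) set \<Rightarrow> ('a \<times> 'a) set \<Rightarrow> 'a list set \<Rightarrow> 'a list set" where
  "coarsen E D c = the_elem (chain_class E ` c)"

text \<open>The infimum of filters defining the uniformity of $X_E$ has the sets \<open>star x0 E D\<close> as a base.\<close>

lemma eventually_unif_chain_space:
  assumes "E \<in> entourages X"
  shows "eventually P (unif (chain_space X x0 E)) \<longleftrightarrow>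
    (\<exists>D\<in>entourages X. D \<subseteq> E \<and> (\<forall>p\<in>star x0 E D. P p))"
proof -
  have "\<exists>C\<in>{D \<in> entourages X. D \<subseteq> E}.
      principal (star x0 E C) \<le> inf (principal (star x0 E A)) (principal (star x0 E B))"
    if "A \<in> {D \<in> entourages X. D \<subseteq> E}" "B \<in> {D \<in> entourages X. D \<subseteq> E}" for A B
  proof (rule bexI[of _ "A \<inter> B"])
    show "A \<inter> B \<in> {D \<in> entourages X. D \<subseteq> E}"
      using that by (auto simp: entourages_def sym_Int eventually_conj)
    show "principal (star x0 E (A \<inter> B)) \<le>
        inf (principal (star x0 E A)) (principal (star x0 E B))"
      by (auto simp: star_def)
  qed
  then show ?thesis
    unfolding chain_space_def using assms
    by (subst uspace.simps, subst eventually_INF_base) (auto simp: eventually_principal)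
qed


section \<open>Universal covers\<close>

text \<open>The index set of all entourages is ordered by reverse inclusion.\<close>

definition univ_space :: "'a uspace \<Rightarrow> 'a \<Rightarrow> (('a \<times> 'a) set \<Rightarrow> 'a list set) uspace" where
  "univ_space X x0 = lim_space (entourages X) (\<lambda>E D. D \<subseteq> E) (chain_space X x0) coarsen"

definition univ_base :: "'a uspace \<Rightarrow> 'a \<Rightarrow> (('a \<times> 'a) set \<Rightarrow> 'a list set)" where
  "univ_base X x0 = (\<lambda>E\<in>entourages X. chain_class E [x0])"

text \<open>The projection to $X_{X \times X}$, which is identified with $X$ by the endpoint map.\<close>

definition univ_cover :: "'a uspace \<Rightarrow> (('a \<times> 'a) set \<Rightarrow> 'a list set) \<Rightarrow> 'a" where
  "univ_cover X \<xi> = endpoint (\<xi> (carrier X \<times> carrier X))"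

definition coverable :: "'a uspace \<Rightarrow> 'a \<Rightarrow> bool" where
  "coverable X x0 \<longleftrightarrow> (\<exists>B. is_base X B \<and> carrier X \<times> carrier X \<in> B \<and>
     (\<forall>E\<in>B. (\<lambda>\<xi>. \<xi> E) ` carrier (univ_space X x0) = carrier (chain_space X x0 E)))"

text \<open>Functions on the carrier are made unique by requiring extensionality.\<close>

definition is_lift ::
  "'a uspace \<Rightarrow> 'a \<Rightarrow> 'b uspace \<Rightarrow> 'b \<Rightarrow> ('a \<Rightarrow> 'b) \<Rightarrow>
   ((('a \<times> 'a) set \<Rightarrow> 'a list set) \<Rightarrow> (('b \<times> 'b) set \<Rightarrow> 'b list set)) \<Rightarrow> bool" where
  "is_lift X x0 Y y0 f F \<longleftrightarrow>
     F \<in> extensional (carrier (univ_space X x0)) \<and>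
     ucont (univ_space X x0) (univ_space Y y0) F \<and>
     F (univ_base X x0) = univ_base Y y0 \<and>
     (\<forall>\<xi>\<in>carrier (univ_space X x0). f (univ_cover X \<xi>) = univ_cover Y (F \<xi>))"

definition the_lift ::
  "'a uspace \<Rightarrow> 'a \<Rightarrow> 'b uspace \<Rightarrow> 'b \<Rightarrow> ('a \<Rightarrow> 'b) \<Rightarrow>
   (('a \<times> 'a) set \<Rightarrow> 'a list set) \<Rightarrow> (('b \<times> 'b) set \<Rightarrow> 'b list set)" where
  "the_lift X x0 Y y0 f = (THE F. is_lift X x0 Y y0 f F)"


section \<open>Group actions and covers\<close>

definition uniform_action :: "'g monoid \<Rightarrow> 'a uspace \<Rightarrow> ('g \<Rightarrow> 'a \<Rightarrow> 'a) \<Rightarrow> bool" where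
  "uniform_action G X act \<longleftrightarrow>
     group_action G (carrier X) act \<and> (\<forall>g\<in>carrier G. uhomeo X X (act g))"

definition isomorphic_action :: "'g monoid \<Rightarrow> 'a uspace \<Rightarrow> ('g \<Rightarrow> 'a \<Rightarrow> 'a) \<Rightarrow> bool" where
  "isomorphic_action G X act \<longleftrightarrow> uniform_action G X act \<and>
     (\<exists>B. is_base X B \<and> (\<forall>E\<in>B. \<forall>g\<in>carrier G. map_prod (act g) (act g) ` E = E))"

definition discrete_action :: "'g monoid \<Rightarrow> 'a uspace \<Rightarrow> ('g \<Rightarrow> 'a \<Rightarrow> 'a) \<Rightarrow> bool" where
  "discrete_action G X act \<longleftrightarrow> uniform_action G X act \<and>
     (\<exists>E\<in>entourages X. \<forall>g\<in>carrier G. (\<exists>x\<in>carrier X. (act g x, x) \<in> E) \<longrightarrow> g = \<one>\<^bsub>G\<^esub>)"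

text \<open>
  The space and the group are identified with the inverse limits by \<open>\<Phi>\<close> and \<open>\<Theta>\<close>.
  The types of the indices and of the points of the factor spaces and groups have to be recorded
  by a type argument; a free type variable in a hypothesis amounts to arbitrary types.
\<close>

definition prodiscrete_action ::
  "('i \<times> 'b \<times> 'h) itself \<Rightarrow> 'g monoid \<Rightarrow> 'a uspace \<Rightarrow> ('g \<Rightarrow> 'a \<Rightarrow> 'a) \<Rightarrow> bool" where
  "prodiscrete_action T G X act \<longleftrightarrow> uniform_action G X act \<and>
     (\<exists>(I :: 'i set) leq (Xs :: 'i \<Rightarrow> 'b uspace) b (Gs :: 'i \<Rightarrow> 'h monoid) h acts \<Phi> \<Theta>.
        directed I leq \<and>
        (\<forall>i\<in>I. uspace (Xs i) \<and> group (Gs i) \<and> discrete_action (Gs i) (Xs i) (acts i)) \<and>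
        functorial I leq (\<lambda>i. carrier (Xs i)) b \<and>
        functorial I leq (\<lambda>i. carrier (Gs i)) h \<and>
        (\<forall>i\<in>I. \<forall>j\<in>I. leq i j \<longrightarrow>
           ucont (Xs j) (Xs i) (b i j) \<and> h i j \<in> hom (Gs j) (Gs i) \<and>
           (\<forall>g\<in>carrier (Gs j). \<forall>x\<in>carrier (Xs j).
              b i j (acts j g x) = acts i (h i j g) (b i j x))) \<and>
        (\<forall>i\<in>I. (\<lambda>x. x i) ` carrier (lim_space I leq Xs b) = carrier (Xs i)) \<and>
        uhomeo X (lim_space I leq Xs b) \<Phi> \<and>
        \<Theta> \<in> iso G (lim_group I leq Gs h) \<and>
        (\<forall>g\<in>carrier G. \<forall>x\<in>carrier X. \<forall>i\<in>I. \<Phi> (act g x) i = acts i (\<Theta> g i) (\<Phi> x i)))"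

text \<open>The filter \<open>filtermap\<close> is the one with base the images of the entourages.\<close>

definition quotient_space :: "'g monoid \<Rightarrow> 'a uspace \<Rightarrow> ('g \<Rightarrow> 'a \<Rightarrow> 'a) \<Rightarrow> 'a set uspace" where
  "quotient_space G X act =
     \<lparr>carrier = orbits G (carrier X) act,
      unif = filtermap (map_prod (orbit G act) (orbit G act)) (unif X)\<rparr>"

definition is_cover ::
  "('g \<times> 'i \<times> 'b \<times> 'h) itself \<Rightarrow> 'a uspace \<Rightarrow> 'c uspace \<Rightarrow> ('a \<Rightarrow> 'c) \<Rightarrow> bool" where
  "is_cover T X Y f \<longleftrightarrow>
     (\<exists>(G :: 'g monoid) act k.
        isomorphic_action G X act \<and>
        prodiscrete_action TYPE('i \<times> 'b \<times> 'h) G X act \<and>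
        uhomeo (quotient_space G X act) Y k \<and>
        (\<forall>x\<in>carrier X. f x = k (orbit G act x)))"

end

theory Submission
  imports Defs
begin

text \<open>
  A uniformly continuous \<open>f\<close> maps chains that are fine with respect to the pullback of an entourage
  \<open>E\<close> of \<open>Y\<close> to \<open>E\<close>-chains, and homotopic chains to homotopic ones.  Hence it induces maps from the
  spaces of chain classes of \<open>X\<close> to \<open>Y\<^sub>E\<close>, and these fit together to a lift \<open>X~ \<longrightarrow> Y~\<close> of \<open>f\<close>
  (\<open>is_lift_lift_map\<close>).  Two lifts agree at the basepoint.  The fibres of \<open>Y\<^sub>E \<longrightarrow> Y\<close> are uniformly
  discrete (\<open>star_same_endpoint\<close>), so the lifts continue to agree along any sequence of
  sufficiently small steps; and coverability makes \<open>X~\<close> chain connected (\<open>univ_connected\<close>).  This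
  gives uniqueness, so that the canonical lift is the only one; canonical lifts compose because
  pullbacks of entourages do (\<open>lift_map_compose\<close>).

  Let now \<open>f\<close> be a cover with group \<open>G\<close>, and let \<open>K\<close> run through the kernels of the maps from
  \<open>G\<close> to the discrete groups of which it is the limit.  The quotient map lifts a chain with small
  links in \<open>Y\<close> to \<open>X\<close>, because invariant entourages form a base.  For a discrete action the lift is
  unique and homotopies lift as well, so that already the chain spaces of \<open>X\<close> and \<open>Y\<close> agree at
  corresponding scales.  For a prodiscrete action both statements hold only modulo \<open>K\<close>: for chains
  that are fine enough, depending on \<open>K\<close>, lifts of homotopic chains have ends that differ by an
  element of \<open>K\<close>.  But orbits of \<open>K\<close> can be taken small, smaller than a given entourage \<open>E\<close>, and then
  the two lifts are \<open>E\<close>-homotopic after the one-step correction of the end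
  (\<open>same_lift_homotopic\<close>).  Injectivity of the lift of \<open>f\<close> and uniform continuity of its inverse
  follow directly.

  For surjectivity one has to find the end of the path in \<open>X~\<close> over a given point of \<open>Y~\<close>.  Lifts of
  finer and finer representatives have ends in one fibre that are determined modulo smaller
  and smaller \<open>K\<close>.  Since \<open>G\<close> acts freely and is the limit of the discrete groups, there is a point of
  the fibre that is the end modulo every \<open>K\<close> (\<open>end_point\<close>); correcting each lift so that
  it ends there makes the classes at all scales coherent (\<open>lift_surj\<close>).
\<close>

section \<open>Entourages\<close>

lemma entourage_subset: "E \<in> entourages X \<Longrightarrow> E \<subseteq> carrier X \<times> carrier X"
  by (simp add: entourages_def)

lemma entourage_sym: "E \<in> entourages X \<Longrightarrow> (x, y) \<in> E \<Longrightarrow> (y, x) \<in> E"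
  by (auto simp: entourages_def dest: symD)

lemma entourage_refl: "uspace X \<Longrightarrow> E \<in> entourages X \<Longrightarrow> x \<in> carrier X \<Longrightarrow> (x, x) \<in> E"
  unfolding uspace_def entourages_def by blast

lemma eventually_carrier: "uspace X \<Longrightarrow> eventually (\<lambda>p. p \<in> carrier X \<times> carrier X) (unif X)"
  by (simp add: uspace_def le_principal)

lemma carrier_entourage: "uspace X \<Longrightarrow> carrier X \<times> carrier X \<in> entourages X"
  using eventually_carrier by (auto simp: entourages_def sym_def)

lemma entourage_Int: "D \<in> entourages X \<Longrightarrow> E \<in> entourages X \<Longrightarrow> D \<inter> E \<in> entourages X"
  by (auto simp: entourages_def sym_Int eventually_conj)

lemma eventually_entourage:
  assumes "uspace X"
  shows "eventually P (unif X) \<longleftrightarrow> (\<exists>E\<in>entourages X. \<forall>p\<in>E. P p)"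
proof
  assume P: "eventually P (unif X)"
  have "eventually (\<lambda>(x, y). P (y, x)) (unif X)"
    using assms P by (simp add: uspace_def)
  with P eventually_carrier[OF assms]
  have "eventually (\<lambda>p. p \<in> {p \<in> carrier X \<times> carrier X. P p \<and> P (snd p, fst p)}) (unif X)"
    by eventually_elim auto
  then show "\<exists>E\<in>entourages X. \<forall>p\<in>E. P p"
    by (intro bexI[of _ "{p \<in> carrier X \<times> carrier X. P p \<and> P (snd p, fst p)}"])
      (auto simp: entourages_def sym_def)
next
  assume "\<exists>E\<in>entourages X. \<forall>p\<in>E. P p"
  then obtain E where E: "E \<in> entourages X" "\<forall>p\<in>E. P p"
    by blast
  then have "eventually (\<lambda>p. p \<in> E) (unif X)"
    by (simp add: entourages_def)
  then show "eventually P (unif X)"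
    by (rule eventually_mono) (use E(2) in blast)
qed

lemma entourage_comp:
  assumes "uspace X" "E \<in> entourages X"
  shows "\<exists>D\<in>entourages X. D O D \<subseteq> E"
proof -
  have "eventually (\<lambda>p. p \<in> E) (unif X)"
    using assms(2) by (simp add: entourages_def)
  moreover have "\<forall>Q. eventually Q (unif X) \<longrightarrow>
      (\<exists>D. eventually D (unif X) \<and> (\<forall>x y z. D (x, y) \<longrightarrow> D (y, z) \<longrightarrow> Q (x, z)))"
    using assms(1) unfolding uspace_def by (elim conjE)
  ultimately obtain P where P: "eventually P (unif X)"
      "\<forall>x y z. P (x, y) \<longrightarrow> P (y, z) \<longrightarrow> (x, z) \<in> E"
    by (elim allE[of _ "\<lambda>p. p \<in> E"]) auto
  then obtain D where "D \<in> entourages X" "\<forall>p\<in>D. P p"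
    using eventually_entourage[OF assms(1)] by blast
  with P(2) have "D O D \<subseteq> E" by blast
  with \<open>D \<in> entourages X\<close> show ?thesis by blast
qed

lemma entourage_comp4:
  assumes "uspace X" "E \<in> entourages X"
  shows "\<exists>D\<in>entourages X. D O D O D O D \<subseteq> E"
proof -
  obtain C where C: "C \<in> entourages X" "C O C \<subseteq> E"
    using entourage_comp[OF assms] by blast
  obtain D where D: "D \<in> entourages X" "D O D \<subseteq> C"
    using entourage_comp[OF assms(1) C(1)] by blast
  have "D O D O D O D = (D O D) O (D O D)"
    by (simp add: O_assoc)
  also have "\<dots> \<subseteq> C O C"
    using D(2) by (intro relcomp_mono)
  finally have "D O D O D O D \<subseteq> E"
    using C(2) by (rule order_trans)
  with D(1) show ?thesis by blast
qed

lemma ucont_eventually: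
  "ucont X Y f \<Longrightarrow> eventually P (unif Y) \<Longrightarrow> eventually (\<lambda>p. P (map_prod f f p)) (unif X)"
  by (simp add: ucont_def filterlim_iff)

definition pullback :: "'a uspace \<Rightarrow> ('a \<Rightarrow> 'b) \<Rightarrow> ('b \<times> 'b) set \<Rightarrow> ('a \<times> 'a) set" where
  "pullback X f E = {(x, y) \<in> carrier X \<times> carrier X. (f x, f y) \<in> E}"

lemma pullback_entourage:
  assumes "uspace X" "ucont X Y f" "E \<in> entourages Y"
  shows "pullback X f E \<in> entourages X"
proof -
  have "eventually (\<lambda>p. p \<in> E) (unif Y)"
    using assms(3) by (simp add: entourages_def)
  then have "eventually (\<lambda>p. map_prod f f p \<in> E) (unif X)"
    by (rule ucont_eventually[OF assms(2)])
  with eventually_carrier[OF assms(1)] have "eventually (\<lambda>p. p \<in> pullback X f E) (unif X)"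
    by eventually_elim (auto simp: pullback_def)
  then show ?thesis
    by (auto simp: entourages_def pullback_def intro!: symI intro: entourage_sym[OF assms(3)])
qed

section \<open>Uniformities of inverse limits\<close>

text \<open>
  Along a directed system the pulled-back uniformities are themselves directed, so that one
  index suffices to describe an entourage of the limit.
\<close>

lemma eventually_lim_space:
  assumes dir: "directed I leq"
    and bond: "\<And>i j. i \<in> I \<Longrightarrow> j \<in> I \<Longrightarrow> leq i j \<Longrightarrow> ucont (X j) (X i) (b i j)"
  defines "L \<equiv> lim_set I leq (\<lambda>i. carrier (X i)) b"
  shows "eventually P (unif (lim_space I leq X b)) \<longleftrightarrow>
    (\<exists>i\<in>I. \<exists>Q. eventually Q (unif (X i)) \<and> (\<forall>x\<in>L. \<forall>y\<in>L. Q (x i, y i) \<longrightarrow> P (x, y)))"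
proof -
  define F where "F i = inf (filtercomap (\<lambda>(x, y). (x i, y i)) (unif (X i))) (principal (L \<times> L))"
    for i
  have ne: "I \<noteq> {}" using dir by (simp add: directed_def)
  have unif: "unif (lim_space I leq X b) = (INF i\<in>I. F i)"
    unfolding lim_space_def L_def[symmetric] Let_def F_def using ne by (simp add: INF_inf_const2)
  have F: "eventually P (F i) \<longleftrightarrow>
      (\<exists>Q. eventually Q (unif (X i)) \<and> (\<forall>x\<in>L. \<forall>y\<in>L. Q (x i, y i) \<longrightarrow> P (x, y)))" for P i
  proof
    assume "eventually P (F i)"
    then obtain Q where "eventually Q (unif (X i))"
        "\<And>p. Q (case p of (x, y) \<Rightarrow> (x i, y i)) \<Longrightarrow> p \<in> L \<times> L \<longrightarrow> P p"
      unfolding F_def eventually_inf_principal eventually_filtercomap by blast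
    then show "\<exists>Q. eventually Q (unif (X i)) \<and> (\<forall>x\<in>L. \<forall>y\<in>L. Q (x i, y i) \<longrightarrow> P (x, y))"
      by (intro exI[of _ Q]) simp
  next
    assume "\<exists>Q. eventually Q (unif (X i)) \<and> (\<forall>x\<in>L. \<forall>y\<in>L. Q (x i, y i) \<longrightarrow> P (x, y))"
    then obtain Q where "eventually Q (unif (X i))" "\<forall>x\<in>L. \<forall>y\<in>L. Q (x i, y i) \<longrightarrow> P (x, y)"
      by blast
    then show "eventually P (F i)"
      unfolding F_def eventually_inf_principal eventually_filtercomap
      by (intro exI[of _ Q]) simp
  qed
  have mono: "F j \<le> F i" if ij: "i \<in> I" "j \<in> I" "leq i j" for i j
  proof (rule filter_leI)
    fix P assume "eventually P (F i)"
    then obtain Q where Q: "eventually Q (unif (X i))" "\<forall>x\<in>L. \<forall>y\<in>L. Q (x i, y i) \<longrightarrow> P (x, y)"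
      unfolding F by blast
    have "eventually (\<lambda>p. Q (map_prod (b i j) (b i j) p)) (unif (X j))"
      using bond[OF ij] Q(1) by (rule ucont_eventually)
    moreover have "\<forall>x\<in>L. \<forall>y\<in>L. Q (map_prod (b i j) (b i j) (x j, y j)) \<longrightarrow> P (x, y)"
      using Q(2) ij by (auto simp: L_def lim_set_def)
    ultimately show "eventually P (F j)"
      unfolding F by blast
  qed
  have "\<exists>k\<in>I. F k \<le> inf (F i) (F j)" if "i \<in> I" "j \<in> I" for i j
  proof -
    have "\<forall>i\<in>I. \<forall>j\<in>I. \<exists>k\<in>I. leq i k \<and> leq j k"
      using dir unfolding directed_def by (elim conjE)
    with that obtain k where k: "k \<in> I" "leq i k" "leq j k"
      by blast
    then have "F k \<le> inf (F i) (F j)"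
      using that by (intro le_infI mono)
    with k(1) show ?thesis ..
  qed
  then show ?thesis
    unfolding unif by (subst eventually_INF_base[OF ne]) (auto simp only: F)
qed

section \<open>Chains and homotopies\<close>

lemma chain_append:
  "xs \<noteq> [] \<Longrightarrow> ys \<noteq> [] \<Longrightarrow> chain E (xs @ ys) \<longleftrightarrow> chain E xs \<and> chain E ys \<and> (last xs, hd ys) \<in> E"
  by (auto simp: chain_def successively_append_iff)

lemma chain_singleton [simp]: "chain E [x]"
  by (simp add: chain_def)

lemma chain_Cons: "ys \<noteq> [] \<Longrightarrow> chain E (x # ys) \<longleftrightarrow> (x, hd ys) \<in> E \<and> chain E ys"
  by (cases ys) (auto simp: chain_def)

lemma chain_snoc: "xs \<noteq> [] \<Longrightarrow> chain E (xs @ [y]) \<longleftrightarrow> chain E xs \<and> (last xs, y) \<in> E"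
  by (simp add: chain_append)

lemma chain_nonempty: "chain E xs \<Longrightarrow> xs \<noteq> []"
  by (simp add: chain_def)

lemma chain_mono: "D \<subseteq> E \<Longrightarrow> chain D xs \<Longrightarrow> chain E xs"
  unfolding chain_def by (auto elim!: successively_mono)

lemma chain_map:
  assumes "\<forall>(x, y)\<in>D. (f x, f y) \<in> E" "chain D xs"
  shows "chain E (map f xs)"
  using assms unfolding chain_def by (auto simp: successively_map elim!: successively_mono)

lemma chain_set:
  assumes "chain E xs" "E \<subseteq> A \<times> A" "hd xs \<in> A"
  shows "set xs \<subseteq> A"
  using assms
proof (induction xs)
  case (Cons x xs)
  then show ?case by (cases xs) (auto simp: chain_Cons)
qed simp

lemma insert_stepI:
  assumes "us = as @ bs" "vs = as @ a # bs" "chain E us" "chain E vs" "hd us = hd vs" "last us = last vs"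
  shows "(us, vs) \<in> insert_step E"
  using assms unfolding insert_step_def by blast

lemma insert_stepE:
  assumes "(us, vs) \<in> insert_step E"
  obtains as a bs where "us = as @ bs" "vs = as @ a # bs" "chain E us" "chain E vs"
    "hd us = hd vs" "last us = last vs"
  using assms unfolding insert_step_def by blast

lemma homotopic_refl [simp]: "(xs, xs) \<in> homotopic E"
  by (simp add: homotopic_def)

lemma homotopic_sym: "(xs, ys) \<in> homotopic E \<Longrightarrow> (ys, xs) \<in> homotopic E"
proof -
  have "sym (homotopic E)"
    unfolding homotopic_def by (intro sym_rtrancl sym_Un_converse)
  then show "(xs, ys) \<in> homotopic E \<Longrightarrow> (ys, xs) \<in> homotopic E"
    by (rule symD)
qed

lemma homotopic_trans [trans]:
  "(xs, ys) \<in> homotopic E \<Longrightarrow> (ys, zs) \<in> homotopic E \<Longrightarrow> (xs, zs) \<in> homotopic E"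
  unfolding homotopic_def by (rule rtrancl_trans)

lemma homotopic_induct [consumes 1, case_names refl insert remove]:
  assumes "(xs, ys) \<in> homotopic E" "P xs"
    and "\<And>us vs. P us \<Longrightarrow> (us, vs) \<in> insert_step E \<Longrightarrow> P vs"
    and "\<And>us vs. P us \<Longrightarrow> (vs, us) \<in> insert_step E \<Longrightarrow> P vs"
  shows "P ys"
  using assms(1) unfolding homotopic_def
proof (induction rule: rtrancl_induct)
  case (step us vs)
  from step(2) show ?case
    using assms(3)[OF step(3)] assms(4)[OF step(3)] by blast
qed (rule assms(2))

lemma insert_step_homotopic: "(xs, ys) \<in> insert_step E \<Longrightarrow> (xs, ys) \<in> homotopic E"
  by (auto simp: homotopic_def)

lemma homotopic_preserves:
  assumes "(xs, ys) \<in> homotopic E"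
  shows homotopic_chain: "chain E xs \<Longrightarrow> chain E ys"
    and homotopic_hd: "hd ys = hd xs"
    and homotopic_last: "last ys = last xs"
proof -
  have "(chain E xs \<longrightarrow> chain E ys) \<and> hd ys = hd xs \<and> last ys = last xs"
    using assms
    by (induction rule: homotopic_induct) (auto simp only: insert_step_def)
  then show "chain E xs \<Longrightarrow> chain E ys" "hd ys = hd xs" "last ys = last xs"
    by auto
qed

lemma homotopic_image:
  assumes "(xs, ys) \<in> homotopic D"
    and "\<And>us vs. (us, vs) \<in> insert_step D \<Longrightarrow> (h us, h vs) \<in> homotopic E"
  shows "(h xs, h ys) \<in> homotopic E"
  using assms(1)
  by (induction rule: homotopic_induct) (blast intro: homotopic_trans homotopic_sym assms(2) homotopic_refl)+

lemma homotopic_map: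
  assumes "(xs, ys) \<in> homotopic D" "\<forall>(x, y)\<in>D. (f x, f y) \<in> E"
  shows "(map f xs, map f ys) \<in> homotopic E"
  using assms(1)
proof (rule homotopic_image)
  fix us vs assume "(us, vs) \<in> insert_step D"
  then obtain as a bs where *: "us = as @ bs" "vs = as @ a # bs" "chain D us" "chain D vs"
      "hd us = hd vs" "last us = last vs"
    by (rule insert_stepE)
  then have "us \<noteq> []" "vs \<noteq> []" by (auto simp: chain_def)
  with *(5,6) have "hd (map f us) = hd (map f vs)" "last (map f us) = last (map f vs)"
    by (auto simp: hd_map last_map)
  moreover have "chain E (map f us)" "chain E (map f vs)"
    using *(3,4) by (auto intro: chain_map[OF assms(2)] simp del: map_append)
  ultimately have "(map f us, map f vs) \<in> insert_step E"
    using *(1,2) by (intro insert_stepI[of _ "map f as" "map f bs" _ "f a"]) simp_all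
  then show "(map f us, map f vs) \<in> homotopic E"
    by (rule insert_step_homotopic)
qed

lemma homotopic_mono: "D \<subseteq> E \<Longrightarrow> (xs, ys) \<in> homotopic D \<Longrightarrow> (xs, ys) \<in> homotopic E"
  using homotopic_map[of xs ys D "\<lambda>x. x" E] by auto

lemma insert_step_snoc:
  assumes "(us, vs) \<in> insert_step E" "(last us, z) \<in> E"
  shows "(us @ [z], vs @ [z]) \<in> insert_step E"
  using assms(1)
proof (rule insert_stepE)
  fix as a bs
  assume *: "us = as @ bs" "vs = as @ a # bs" "chain E us" "chain E vs"
    "hd us = hd vs" "last us = last vs"
  then have "us \<noteq> []" "vs \<noteq> []" by (auto simp: chain_def)
  then have "chain E (us @ [z])" "chain E (vs @ [z])" "hd (us @ [z]) = hd (vs @ [z])"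
    using *(3-6) assms(2) by (simp_all only: chain_snoc hd_append2 simp_thms)
  then show ?thesis
    using *(1,2) by (intro insert_stepI[of _ as "bs @ [z]" _ a]) simp_all
qed

lemma homotopic_snoc:
  assumes "(xs, ys) \<in> homotopic E" "(last xs, z) \<in> E"
  shows "(xs @ [z], ys @ [z]) \<in> homotopic E"
proof -
  have "(xs @ [z], ys @ [z]) \<in> homotopic E \<and> (last ys, z) \<in> E"
    using assms(1)
  proof (induction rule: homotopic_induct)
    case refl
    then show ?case using assms(2) by simp
  next
    case (insert us vs)
    from insert(2) have "last us = last vs"
      by (rule insert_stepE)
    moreover have "(us @ [z], vs @ [z]) \<in> homotopic E"
      using insert by (auto intro: insert_step_homotopic insert_step_snoc)
    ultimately show ?case
      using insert(1) by (auto intro: homotopic_trans)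
  next
    case (remove us vs)
    from remove(2) have "last us = last vs"
      by (rule insert_stepE) simp
    moreover from this have "(us @ [z], vs @ [z]) \<in> homotopic E"
      using remove by (auto intro: homotopic_sym insert_step_homotopic insert_step_snoc)
    ultimately show ?case
      using remove(1) by (auto intro: homotopic_trans)
  qed
  then show ?thesis ..
qed

text \<open>
  Together with invariance under appending a point, the next two moves at the end of a chain
  produce every homotopy that is needed between explicitly given chains.
\<close>

lemma homotopic_detour:
  assumes "chain E xs" "(last xs, z) \<in> E" "(last xs, y) \<in> E" "(y, z) \<in> E"
  shows "(xs @ [z], xs @ [y, z]) \<in> homotopic E"
proof -
  have "xs \<noteq> []" using assms(1) by (auto simp: chain_def)
  then have "(xs @ [z], xs @ [y, z]) \<in> insert_step E"
    using assms by (intro insert_stepI[of _ xs "[z]" _ y]) (simp_all add: chain_append chain_Cons)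
  then show ?thesis by (rule insert_step_homotopic)
qed

lemma homotopic_stutter:
  assumes "chain E xs" "(last xs, last xs) \<in> E"
  shows "(xs @ [last xs], xs) \<in> homotopic E"
proof -
  have "xs \<noteq> []" using assms(1) by (auto simp: chain_def)
  then have "(xs, xs @ [last xs]) \<in> insert_step E"
    using assms by (intro insert_stepI[of _ xs "[]" _ "last xs"]) (simp_all add: chain_append)
  then show ?thesis by (blast intro: insert_step_homotopic homotopic_sym)
qed

lemma chain_class_eq_iff: "chain_class E xs = chain_class E ys \<longleftrightarrow> (xs, ys) \<in> homotopic E"
  unfolding chain_class_def
  by (auto intro: homotopic_trans homotopic_sym dest: homotopic_sym)

text \<open>
  Images of classes in the definitions of endpoints and of maps between chain spaces are singletons,
  and their unique element is computed by any representative.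
\<close>

lemma the_elem_class:
  assumes "\<And>ys. (xs, ys) \<in> homotopic E \<Longrightarrow> h ys = h xs"
  shows "the_elem (h ` chain_class E xs) = h xs"
proof (rule the_elem_image_unique)
  show "chain_class E xs \<noteq> {}"
    using homotopic_refl[of xs E] unfolding chain_class_def by blast
  show "h ys = h xs" if "ys \<in> chain_class E xs" for ys
    using that unfolding chain_class_def by (intro assms) simp
qed

lemma endpoint_class [simp]: "endpoint (chain_class E xs) = last xs"
  unfolding endpoint_def by (rule the_elem_class) (rule homotopic_last)

lemma coarsen_class: "D \<subseteq> E \<Longrightarrow> coarsen E D (chain_class D xs) = chain_class E xs"
  unfolding coarsen_def
  by (rule the_elem_class) (unfold chain_class_eq_iff, rule homotopic_sym, rule homotopic_mono)

lemma carrier_chain_space: "carrier (chain_space X x0 E) = chain_class E ` chains_from x0 E"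
  by (auto simp: chain_space_def quotient_def chain_class_def)

lemma chains_from_nonempty: "xs \<in> chains_from x0 E \<Longrightarrow> xs \<noteq> []"
  by (auto simp: chains_from_def dest: chain_nonempty)

lemma chains_from_mono: "D \<subseteq> E \<Longrightarrow> xs \<in> chains_from x0 D \<Longrightarrow> xs \<in> chains_from x0 E"
  by (auto simp: chains_from_def intro: chain_mono)

lemma chains_from_homotopic:
  "xs \<in> chains_from x0 E \<Longrightarrow> (xs, ys) \<in> homotopic E \<Longrightarrow> ys \<in> chains_from x0 E"
  by (auto simp: chains_from_def intro: homotopic_chain dest: homotopic_hd)

lemma chains_from_snoc:
  "xs \<in> chains_from x0 E \<Longrightarrow> (last xs, y) \<in> E \<Longrightarrow> xs @ [y] \<in> chains_from x0 E"
  using chain_nonempty by (auto simp: chains_from_def chain_snoc hd_append)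

lemma chains_from_butlast:
  "xs \<noteq> [] \<Longrightarrow> xs @ [y] \<in> chains_from x0 E \<Longrightarrow> xs \<in> chains_from x0 E \<and> (last xs, y) \<in> E"
  by (auto simp: chains_from_def chain_snoc)

lemma chains_from_map:
  assumes "\<forall>(x, y)\<in>D. (f x, f y) \<in> E" "xs \<in> chains_from x0 D"
  shows "map f xs \<in> chains_from (f x0) E"
  using assms chain_map[OF assms(1)] by (auto simp: chains_from_def hd_map chain_def)

lemma chains_from_last:
  assumes "E \<in> entourages X" "x0 \<in> carrier X" "xs \<in> chains_from x0 E"
  shows "last xs \<in> carrier X"
proof -
  have "set xs \<subseteq> carrier X"
    using chain_set[of E xs "carrier X"] entourage_subset assms
    by (auto simp: chains_from_def)
  moreover have "xs \<noteq> []" using assms(3) by (auto simp: chains_from_def chain_def)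
  ultimately show ?thesis by auto
qed

lemma starI:
  assumes "xs \<in> chains_from x0 E" "(last xs, y) \<in> E" "(last xs, z) \<in> E" "(y, z) \<in> D"
  shows "(chain_class E (xs @ [y]), chain_class E (xs @ [z])) \<in> star x0 E D"
proof -
  have "xs \<noteq> []" using assms(1) by (auto simp: chains_from_def chain_def)
  then show ?thesis
    using chains_from_snoc[OF assms(1)] assms(2-) unfolding star_def by blast
qed

lemma starE:
  assumes "(c, d) \<in> star x0 E D"
  obtains xs y z where "xs \<in> chains_from x0 E" "(last xs, y) \<in> E" "(last xs, z) \<in> E" "(y, z) \<in> D"
    "c = chain_class E (xs @ [y])" "d = chain_class E (xs @ [z])"
proof -
  obtain xs y z where *: "c = chain_class E (xs @ [y])" "d = chain_class E (xs @ [z])" "xs \<noteq> []"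
    "xs @ [y] \<in> chains_from x0 E" "xs @ [z] \<in> chains_from x0 E" "(y, z) \<in> D"
    using assms unfolding star_def by blast
  show thesis
    by (rule that[of xs y z])
      (use * chains_from_butlast[OF *(3,4)] chains_from_butlast[OF *(3,5)] in simp_all)
qed

lemma star_map:
  assumes "(chain_class C xs, chain_class C ys) \<in> star x0 C D"
    and "\<forall>(x, y)\<in>C. (f x, f y) \<in> C'" "\<forall>(x, y)\<in>D. (f x, f y) \<in> D'"
  shows "(chain_class C' (map f xs), chain_class C' (map f ys)) \<in> star (f x0) C' D'"
proof -
  obtain as y z where *: "as \<in> chains_from x0 C" "(last as, y) \<in> C" "(last as, z) \<in> C" "(y, z) \<in> D"
    "chain_class C xs = chain_class C (as @ [y])" "chain_class C ys = chain_class C (as @ [z])"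
    using assms(1) by (rule starE)
  have "as \<noteq> []" using *(1) by (auto simp: chains_from_def chain_def)
  then have "(chain_class C' (map f as @ [f y]), chain_class C' (map f as @ [f z])) \<in> star (f x0) C' D'"
    using * assms(2,3) chains_from_map[OF assms(2) *(1)] by (intro starI) (auto simp: last_map)
  moreover have "chain_class C' (map f xs) = chain_class C' (map f as @ [f y])"
      "chain_class C' (map f ys) = chain_class C' (map f as @ [f z])"
    using homotopic_map[OF _ assms(2), of xs "as @ [y]"] homotopic_map[OF _ assms(2), of ys "as @ [z]"] *(5,6)
    by (simp_all add: chain_class_eq_iff)
  ultimately show ?thesis by simp
qed

section \<open>The inverse limit of the chain spaces\<close>

lemma directed_entourages: "uspace X \<Longrightarrow> directed (entourages X) (\<lambda>E D. D \<subseteq> E)"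
  unfolding directed_def
proof (intro conjI ballI impI)
  fix D E assume "D \<in> entourages X" "E \<in> entourages X"
  then show "\<exists>C\<in>entourages X. C \<subseteq> D \<and> C \<subseteq> E"
    by (intro bexI[of _ "D \<inter> E"] entourage_Int) auto
qed (use carrier_entourage in auto)

lemma ucont_coarsen:
  assumes "D \<in> entourages X" "E \<in> entourages X" "D \<subseteq> E"
  shows "ucont (chain_space X x0 D) (chain_space X x0 E) (coarsen E D)"
  unfolding ucont_def filterlim_iff
proof (intro conjI allI impI)
  show "coarsen E D \<in> carrier (chain_space X x0 D) \<rightarrow> carrier (chain_space X x0 E)"
    using assms(3) chains_from_mono[OF assms(3)]
    by (auto simp: carrier_chain_space coarsen_class)
  fix P assume "eventually P (unif (chain_space X x0 E))"
  then obtain C where C: "C \<in> entourages X" "C \<subseteq> E" "\<forall>p\<in>star x0 E C. P p"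
    unfolding eventually_unif_chain_space[OF assms(2)] by blast
  have "\<forall>p\<in>star x0 D (C \<inter> D). P (map_prod (coarsen E D) (coarsen E D) p)"
  proof
    fix p assume p: "p \<in> star x0 D (C \<inter> D)"
    obtain c d where cd: "p = (c, d)" by (rule prod.exhaust)
    obtain as bs where p_eq: "p = (chain_class D as, chain_class D bs)"
      using p unfolding cd by (rule starE) simp
    then have "(chain_class E as, chain_class E bs) \<in> star x0 E C"
      using star_map[of D as bs x0 "C \<inter> D" "\<lambda>x. x" E C] p assms(3) by auto
    then show "P (map_prod (coarsen E D) (coarsen E D) p)"
      using C(3) assms(3) by (simp add: p_eq coarsen_class)
  qed
  then show "eventually (\<lambda>p. P (map_prod (coarsen E D) (coarsen E D) p)) (unif (chain_space X x0 D))"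
    unfolding eventually_unif_chain_space[OF assms(1)] using C(1) assms(1)
    by (intro bexI[of _ "C \<inter> D"] conjI entourage_Int) auto
qed

lemma carrier_univ_space:
  "carrier (univ_space X x0) =
    {\<xi> \<in> (\<Pi>\<^sub>E E\<in>entourages X. chain_class E ` chains_from x0 E).
      \<forall>E\<in>entourages X. \<forall>D\<in>entourages X. D \<subseteq> E \<longrightarrow> coarsen E D (\<xi> D) = \<xi> E}"
  by (simp add: univ_space_def lim_space_def lim_set_def Let_def carrier_chain_space)

lemma univ_rep:
  assumes "\<xi> \<in> carrier (univ_space X x0)" "E \<in> entourages X"
  obtains \<alpha> where "\<alpha> \<in> chains_from x0 E" "\<xi> E = chain_class E \<alpha>"
proof -
  have "\<xi> E \<in> chain_class E ` chains_from x0 E"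
    using assms by (auto simp: carrier_univ_space PiE_iff)
  with that show thesis by blast
qed

lemma univ_coarse:
  assumes "\<xi> \<in> carrier (univ_space X x0)" "D \<in> entourages X" "E \<in> entourages X" "D \<subseteq> E"
    and "\<xi> D = chain_class D \<alpha>"
  shows "\<xi> E = chain_class E \<alpha>"
proof -
  have "coarsen E D (\<xi> D) = \<xi> E"
    using assms(1-4) by (simp add: carrier_univ_space)
  then show ?thesis using assms(4,5) by (simp add: coarsen_class)
qed

lemma univ_ext:
  assumes "\<xi> \<in> carrier (univ_space X x0)" "\<eta> \<in> carrier (univ_space X x0)"
    and "\<And>E. E \<in> entourages X \<Longrightarrow> \<xi> E = \<eta> E"
  shows "\<xi> = \<eta>"
proof (rule PiE_ext)
  show "\<xi> \<in> (\<Pi>\<^sub>E E\<in>entourages X. chain_class E ` chains_from x0 E)"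
    using assms(1) unfolding carrier_univ_space mem_Collect_eq by (rule conjunct1)
  show "\<eta> \<in> (\<Pi>\<^sub>E E\<in>entourages X. chain_class E ` chains_from x0 E)"
    using assms(2) unfolding carrier_univ_space mem_Collect_eq by (rule conjunct1)
qed (rule assms(3))

lemma univI:
  assumes "\<xi> \<in> extensional (entourages X)"
    and "\<And>D E. D \<in> entourages X \<Longrightarrow> E \<in> entourages X \<Longrightarrow> D \<subseteq> E \<Longrightarrow>
      \<exists>\<alpha>\<in>chains_from x0 D. \<xi> D = chain_class D \<alpha> \<and> \<xi> E = chain_class E \<alpha>"
  shows "\<xi> \<in> carrier (univ_space X x0)"
  unfolding carrier_univ_space mem_Collect_eq
proof (intro conjI ballI impI)
  show "\<xi> \<in> (\<Pi>\<^sub>E E\<in>entourages X. chain_class E ` chains_from x0 E)"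
  proof (rule PiE_I)
    fix E assume "E \<in> entourages X"
    then obtain \<alpha> where "\<alpha> \<in> chains_from x0 E" "\<xi> E = chain_class E \<alpha>"
      using assms(2)[of E E] by blast
    then show "\<xi> E \<in> chain_class E ` chains_from x0 E" by simp
  qed (use assms(1) in \<open>simp add: extensional_def\<close>)
  fix D E assume *: "D \<in> entourages X" "E \<in> entourages X" "D \<subseteq> E"
  obtain \<alpha> where "\<xi> D = chain_class D \<alpha>" "\<xi> E = chain_class E \<alpha>"
    using assms(2)[OF *] by blast
  then show "coarsen E D (\<xi> D) = \<xi> E"
    using *(3) by (simp add: coarsen_class)
qed

lemma univ_base_in: "univ_base X x0 \<in> carrier (univ_space X x0)"
proof (rule univI)
  fix D E assume "D \<in> entourages X" "E \<in> entourages X"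
  then show "\<exists>\<alpha>\<in>chains_from x0 D. univ_base X x0 D = chain_class D \<alpha> \<and> univ_base X x0 E = chain_class E \<alpha>"
    by (intro bexI[of _ "[x0]"]) (simp_all add: univ_base_def chains_from_def)
qed (simp add: univ_base_def)

lemma univ_cover_eq:
  assumes "uspace X" "\<xi> \<in> carrier (univ_space X x0)" "E \<in> entourages X" "\<xi> E = chain_class E \<alpha>"
  shows "univ_cover X \<xi> = last \<alpha>"
  using univ_coarse[OF assms(2,3) carrier_entourage[OF assms(1)] entourage_subset[OF assms(3)] assms(4)]
  by (simp add: univ_cover_def)

lemma endpoint_univ:
  assumes "uspace X" "\<xi> \<in> carrier (univ_space X x0)" "E \<in> entourages X"
  shows "endpoint (\<xi> E) = univ_cover X \<xi>"
proof -
  obtain \<alpha> where "\<xi> E = chain_class E \<alpha>"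
    by (rule univ_rep[OF assms(2,3)])
  then show ?thesis
    using univ_cover_eq[OF assms(1-3)] by simp
qed

lemma univ_cover_in:
  assumes "uspace X" "x0 \<in> carrier X" "\<xi> \<in> carrier (univ_space X x0)"
  shows "univ_cover X \<xi> \<in> carrier X"
proof -
  note E = carrier_entourage[OF assms(1)]
  obtain \<alpha> where \<alpha>: "\<alpha> \<in> chains_from x0 (carrier X \<times> carrier X)"
      "\<xi> (carrier X \<times> carrier X) = chain_class (carrier X \<times> carrier X) \<alpha>"
    by (rule univ_rep[OF assms(3) E])
  show ?thesis
    using univ_cover_eq[OF assms(1,3) E \<alpha>(2)] chains_from_last[OF E assms(2) \<alpha>(1)] by simp
qed

lemma star_coarse:
  assumes "\<xi> \<in> carrier (univ_space X x0)" "\<eta> \<in> carrier (univ_space X x0)"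
    and "D \<in> entourages X" "E \<in> entourages X" "D \<subseteq> E" "D' \<subseteq> E'"
    and "(\<xi> D, \<eta> D) \<in> star x0 D D'"
  shows "(\<xi> E, \<eta> E) \<in> star x0 E E'"
proof -
  obtain as bs where eq: "\<xi> D = chain_class D as" "\<eta> D = chain_class D bs"
    by (rule univ_rep[OF assms(1,3)], rule univ_rep[OF assms(2,3)])
  then have "(chain_class E as, chain_class E bs) \<in> star x0 E E'"
    using star_map[of D as bs x0 D' "\<lambda>x. x" E E'] assms(5-7) by auto
  then show ?thesis
    using univ_coarse[OF assms(1,3,4,5) eq(1)] univ_coarse[OF assms(2,3,4,5) eq(2)] by simp
qed

text \<open>
  A basic entourage \<open>star x0 E C\<close> of \<open>X\<^sub>E\<close> pulls back to a larger set than \<open>star x0 C C\<close> does from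
  \<open>X\<^sub>C\<close>, so the entourages of the limit have a base that is indexed by the entourages of \<open>X\<close> alone.
\<close>

lemma eventually_univ_space:
  assumes "uspace X"
  shows "eventually P (unif (univ_space X x0)) \<longleftrightarrow>
    (\<exists>E\<in>entourages X. \<forall>\<xi>\<in>carrier (univ_space X x0). \<forall>\<eta>\<in>carrier (univ_space X x0).
       (\<xi> E, \<eta> E) \<in> star x0 E E \<longrightarrow> P (\<xi>, \<eta>))" (is "?lhs \<longleftrightarrow> ?rhs")
proof -
  let ?U = "carrier (univ_space X x0)"
  have U: "lim_set (entourages X) (\<lambda>E D. D \<subseteq> E) (\<lambda>E. carrier (chain_space X x0 E)) coarsen = ?U"
    by (simp add: univ_space_def lim_space_def Let_def)
  have lim: "?lhs \<longleftrightarrow> (\<exists>E\<in>entourages X. \<exists>Q. eventually Q (unif (chain_space X x0 E)) \<and>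
      (\<forall>\<xi>\<in>?U. \<forall>\<eta>\<in>?U. Q (\<xi> E, \<eta> E) \<longrightarrow> P (\<xi>, \<eta>)))"
    unfolding univ_space_def[of X x0]
    by (subst eventually_lim_space[OF directed_entourages[OF assms] ucont_coarsen])
      (simp_all only: U univ_space_def[symmetric])
  show ?thesis
  proof
    assume ?lhs
    then obtain E Q where E: "E \<in> entourages X" and Q: "eventually Q (unif (chain_space X x0 E))"
        and P: "\<forall>\<xi>\<in>?U. \<forall>\<eta>\<in>?U. Q (\<xi> E, \<eta> E) \<longrightarrow> P (\<xi>, \<eta>)"
      unfolding lim by blast
    obtain C where C: "C \<in> entourages X" "C \<subseteq> E" "\<forall>p\<in>star x0 E C. Q p"
      using Q unfolding eventually_unif_chain_space[OF E] by blast
    have "P (\<xi>, \<eta>)" if "\<xi> \<in> ?U" "\<eta> \<in> ?U" "(\<xi> C, \<eta> C) \<in> star x0 C C" for \<xi> \<eta>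
      using star_coarse[OF that(1,2) C(1) E C(2) order_refl that(3)] C(3) P that(1,2) by blast
    with C(1) show ?rhs by blast
  next
    assume ?rhs
    then obtain E where E: "E \<in> entourages X"
        "\<forall>\<xi>\<in>?U. \<forall>\<eta>\<in>?U. (\<xi> E, \<eta> E) \<in> star x0 E E \<longrightarrow> P (\<xi>, \<eta>)"
      by blast
    have "eventually (\<lambda>p. p \<in> star x0 E E) (unif (chain_space X x0 E))"
      unfolding eventually_unif_chain_space[OF E(1)] using E(1) by blast
    with E show ?lhs
      unfolding lim by (intro bexI[of _ E] exI[of _ "\<lambda>p. p \<in> star x0 E E"]) auto
  qed
qed

lemma ucont_univ_iff:
  assumes "uspace X" "uspace Y"
  shows "ucont (univ_space X x0) (univ_space Y y0) F \<longleftrightarrow>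
    F \<in> carrier (univ_space X x0) \<rightarrow> carrier (univ_space Y y0) \<and>
    (\<forall>E\<in>entourages Y. \<exists>D\<in>entourages X.
       \<forall>\<xi>\<in>carrier (univ_space X x0). \<forall>\<eta>\<in>carrier (univ_space X x0).
         (\<xi> D, \<eta> D) \<in> star x0 D D \<longrightarrow> (F \<xi> E, F \<eta> E) \<in> star y0 E E)"
    (is "_ \<longleftrightarrow> ?maps \<and> ?close")
proof -
  have "filterlim (map_prod F F) (unif (univ_space Y y0)) (unif (univ_space X x0)) \<longleftrightarrow> ?close"
    if maps: ?maps
  proof
    assume lim: "filterlim (map_prod F F) (unif (univ_space Y y0)) (unif (univ_space X x0))"
    show ?close
    proof
      fix E assume "E \<in> entourages Y"
      then have "eventually (\<lambda>(\<xi>, \<eta>). (\<xi> E, \<eta> E) \<in> star y0 E E) (unif (univ_space Y y0))"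
        unfolding eventually_univ_space[OF assms(2)] by (intro bexI[of _ E]) auto
      then have "eventually (\<lambda>p. case map_prod F F p of (\<xi>, \<eta>) \<Rightarrow> (\<xi> E, \<eta> E) \<in> star y0 E E)
          (unif (univ_space X x0))"
        by (rule eventually_compose_filterlim[OF _ lim])
      then show "\<exists>D\<in>entourages X. \<forall>\<xi>\<in>carrier (univ_space X x0). \<forall>\<eta>\<in>carrier (univ_space X x0).
          (\<xi> D, \<eta> D) \<in> star x0 D D \<longrightarrow> (F \<xi> E, F \<eta> E) \<in> star y0 E E"
        unfolding eventually_univ_space[OF assms(1)] by simp
    qed
  next
    assume close: ?close
    show "filterlim (map_prod F F) (unif (univ_space Y y0)) (unif (univ_space X x0))"
      unfolding filterlim_iff
    proof (intro allI impI)
      fix P assume "eventually P (unif (univ_space Y y0))"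
      then obtain E where E: "E \<in> entourages Y"
          "\<forall>\<xi>\<in>carrier (univ_space Y y0). \<forall>\<eta>\<in>carrier (univ_space Y y0).
             (\<xi> E, \<eta> E) \<in> star y0 E E \<longrightarrow> P (\<xi>, \<eta>)"
        unfolding eventually_univ_space[OF assms(2)] by blast
      obtain D where D: "D \<in> entourages X"
          "\<forall>\<xi>\<in>carrier (univ_space X x0). \<forall>\<eta>\<in>carrier (univ_space X x0).
             (\<xi> D, \<eta> D) \<in> star x0 D D \<longrightarrow> (F \<xi> E, F \<eta> E) \<in> star y0 E E"
        using close E(1) by blast
      show "eventually (\<lambda>p. P (map_prod F F p)) (unif (univ_space X x0))"
        unfolding eventually_univ_space[OF assms(1)]
      proof (intro bexI[OF _ D(1)] ballI impI)
        fix \<xi> \<eta>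
        assume "\<xi> \<in> carrier (univ_space X x0)" "\<eta> \<in> carrier (univ_space X x0)"
          "(\<xi> D, \<eta> D) \<in> star x0 D D"
        moreover from this maps have "F \<xi> \<in> carrier (univ_space Y y0)" "F \<eta> \<in> carrier (univ_space Y y0)"
          by auto
        ultimately have "P (F \<xi>, F \<eta>)" using D(2) E(2) by blast
        then show "P (map_prod F F (\<xi>, \<eta>))" by simp
      qed
    qed
  qed
  then show ?thesis unfolding ucont_def by blast
qed

section \<open>Existence of lifts\<close>

definition chain_push :: "('b \<times> 'b) set \<Rightarrow> ('a \<Rightarrow> 'b) \<Rightarrow> 'a list set \<Rightarrow> 'b list set" where
  "chain_push E f c = the_elem ((\<lambda>xs. chain_class E (map f xs)) ` c)"

definition lift_map :: "'a uspace \<Rightarrow> 'a \<Rightarrow> 'b uspace \<Rightarrow> ('a \<Rightarrow> 'b) \<Rightarrow>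
    (('a \<times> 'a) set \<Rightarrow> 'a list set) \<Rightarrow> ('b \<times> 'b) set \<Rightarrow> 'b list set" where
  "lift_map X x0 Y f =
    (\<lambda>\<xi>\<in>carrier (univ_space X x0). \<lambda>E\<in>entourages Y. chain_push E f (\<xi> (pullback X f E)))"

lemma chain_push_class:
  assumes "\<forall>(x, y)\<in>D. (f x, f y) \<in> E"
  shows "chain_push E f (chain_class D xs) = chain_class E (map f xs)"
  unfolding chain_push_def
proof (rule the_elem_class)
  fix ys assume "(xs, ys) \<in> homotopic D"
  then show "chain_class E (map f ys) = chain_class E (map f xs)"
    unfolding chain_class_eq_iff by (rule homotopic_sym[OF homotopic_map[OF _ assms]])
qed

text \<open>
  The pullback of \<open>E\<close> is the coarsest entourage whose chains \<open>f\<close> maps to \<open>E\<close>-chains; by coherence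
  any finer one computes the same class.
\<close>

lemma lift_map_eq:
  assumes "uspace X" "ucont X Y f" "\<xi> \<in> carrier (univ_space X x0)"
    and "D \<in> entourages X" "E \<in> entourages Y" "\<forall>(x, y)\<in>D. (f x, f y) \<in> E"
    and "\<xi> D = chain_class D \<alpha>"
  shows "lift_map X x0 Y f \<xi> E = chain_class E (map f \<alpha>)"
proof -
  have "D \<subseteq> pullback X f E"
    using entourage_subset[OF assms(4)] assms(6) by (auto simp: pullback_def)
  then have "\<xi> (pullback X f E) = chain_class (pullback X f E) \<alpha>"
    using univ_coarse[OF assms(3,4) pullback_entourage[OF assms(1,2,5)]] assms(7) by blast
  then show ?thesis
    using assms(3,5) by (simp add: lift_map_def chain_push_class pullback_def)
qed

lemma lift_map_in:
  assumes "uspace X" "ucont X Y f" "f x0 = y0" "\<xi> \<in> carrier (univ_space X x0)"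
  shows "lift_map X x0 Y f \<xi> \<in> carrier (univ_space Y y0)"
proof (rule univI)
  show "lift_map X x0 Y f \<xi> \<in> extensional (entourages Y)"
    using assms(4) by (simp add: lift_map_def)
  fix C E assume *: "C \<in> entourages Y" "E \<in> entourages Y" "C \<subseteq> E"
  note D = pullback_entourage[OF assms(1,2) *(1)]
  obtain \<alpha> where \<alpha>: "\<alpha> \<in> chains_from x0 (pullback X f C)"
      "\<xi> (pullback X f C) = chain_class (pullback X f C) \<alpha>"
    by (rule univ_rep[OF assms(4) D])
  have C: "\<forall>(x, y)\<in>pullback X f C. (f x, f y) \<in> C"
    by (auto simp: pullback_def)
  then have E: "\<forall>(x, y)\<in>pullback X f C. (f x, f y) \<in> E"
    using *(3) by auto
  show "\<exists>\<beta>\<in>chains_from y0 C. lift_map X x0 Y f \<xi> C = chain_class C \<beta> \<and>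
      lift_map X x0 Y f \<xi> E = chain_class E \<beta>"
    using chains_from_map[OF C \<alpha>(1)] lift_map_eq[OF assms(1,2,4) D *(1) C \<alpha>(2)]
      lift_map_eq[OF assms(1,2,4) D *(2) E \<alpha>(2)] assms(3)
    by (intro bexI[of _ "map f \<alpha>"]) simp_all
qed

lemma is_lift_lift_map:
  assumes "uspace X" "uspace Y" "x0 \<in> carrier X" "ucont X Y f" "f x0 = y0"
  shows "is_lift X x0 Y y0 f (lift_map X x0 Y f)"
  unfolding is_lift_def
proof (intro conjI ballI)
  let ?F = "lift_map X x0 Y f" and ?U = "carrier (univ_space X x0)"
  have pull: "\<forall>(x, y)\<in>pullback X f E. (f x, f y) \<in> E" for E
    by (auto simp: pullback_def)
  show "?F \<in> extensional ?U"
    by (simp add: lift_map_def)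
  show "ucont (univ_space X x0) (univ_space Y y0) ?F"
    unfolding ucont_univ_iff[OF assms(1,2)]
  proof (intro conjI ballI)
    show "?F \<in> ?U \<rightarrow> carrier (univ_space Y y0)"
      using lift_map_in[OF assms(1,4,5)] by simp
    fix E assume E: "E \<in> entourages Y"
    note D = pullback_entourage[OF assms(1,4) E]
    show "\<exists>D\<in>entourages X. \<forall>\<xi>\<in>?U. \<forall>\<eta>\<in>?U. (\<xi> D, \<eta> D) \<in> star x0 D D \<longrightarrow> (?F \<xi> E, ?F \<eta> E) \<in> star y0 E E"
    proof (intro bexI[OF _ D] ballI impI)
      fix \<xi> \<eta> assume *: "\<xi> \<in> ?U" "\<eta> \<in> ?U"
        "(\<xi> (pullback X f E), \<eta> (pullback X f E)) \<in> star x0 (pullback X f E) (pullback X f E)"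
      obtain \<alpha> where \<alpha>: "\<xi> (pullback X f E) = chain_class (pullback X f E) \<alpha>"
        by (rule univ_rep[OF *(1) D])
      obtain \<beta> where \<beta>: "\<eta> (pullback X f E) = chain_class (pullback X f E) \<beta>"
        by (rule univ_rep[OF *(2) D])
      show "(?F \<xi> E, ?F \<eta> E) \<in> star y0 E E"
        using star_map[OF *(3)[unfolded \<alpha> \<beta>] pull pull] assms(5)
        by (simp add: lift_map_eq[OF assms(1,4) *(1) D E pull \<alpha>]
            lift_map_eq[OF assms(1,4) *(2) D E pull \<beta>])
    qed
  qed
  show "?F (univ_base X x0) = univ_base Y y0"
  proof (rule univ_ext[OF lift_map_in[OF assms(1,4,5) univ_base_in] univ_base_in])
    fix E assume E: "E \<in> entourages Y"
    note D = pullback_entourage[OF assms(1,4) E]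
    have "univ_base X x0 (pullback X f E) = chain_class (pullback X f E) [x0]"
      using D by (simp add: univ_base_def)
    from lift_map_eq[OF assms(1,4) univ_base_in D E pull this]
    show "?F (univ_base X x0) E = univ_base Y y0 E"
      using E assms(5) by (simp add: univ_base_def[of Y])
  qed
  fix \<xi> assume \<xi>: "\<xi> \<in> ?U"
  note E = carrier_entourage[OF assms(2)]
  note D = pullback_entourage[OF assms(1,4) E]
  obtain \<alpha> where \<alpha>: "\<alpha> \<in> chains_from x0 (pullback X f (carrier Y \<times> carrier Y))"
      "\<xi> (pullback X f (carrier Y \<times> carrier Y)) = chain_class (pullback X f (carrier Y \<times> carrier Y)) \<alpha>"
    by (rule univ_rep[OF \<xi> D])
  from \<alpha>(1) have "\<alpha> \<noteq> []"
    by (rule chains_from_nonempty)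
  then show "f (univ_cover X \<xi>) = univ_cover Y (?F \<xi>)"
    using univ_cover_eq[OF assms(1) \<xi> D \<alpha>(2)]
      univ_cover_eq[OF assms(2) lift_map_in[OF assms(1,4,5) \<xi>] E
        lift_map_eq[OF assms(1,4) \<xi> D E pull \<alpha>(2)]]
    by (simp add: last_map)
qed

section \<open>Uniqueness of lifts\<close>

text \<open>
  The inverse limit over a coverable space is chain connected: if \<open>\<phi>\<^sub>D\<close> is onto, the initial
  segments of a \<open>D\<close>-chain representing \<open>\<xi> D\<close> lift to points that lead from the basepoint to \<open>\<xi>\<close> in
  small steps.
\<close>

lemma univ_connected:
  assumes X: "uspace X" "x0 \<in> carrier X" "coverable X x0" and E: "E \<in> entourages X"
    and base: "P (univ_base X x0)"
    and step: "\<And>\<xi> \<eta>. \<xi> \<in> carrier (univ_space X x0) \<Longrightarrow> \<eta> \<in> carrier (univ_space X x0) \<Longrightarrow> P \<xi> \<Longrightarrow>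
      (\<xi> E, \<eta> E) \<in> star x0 E E \<Longrightarrow> P \<eta>"
    and \<xi>: "\<xi> \<in> carrier (univ_space X x0)"
  shows "P \<xi>"
proof -
  obtain B where B: "is_base X B"
      "\<forall>D\<in>B. (\<lambda>\<xi>. \<xi> D) ` carrier (univ_space X x0) = carrier (chain_space X x0 D)"
    using X(3) unfolding coverable_def by (elim exE conjE)
  obtain D where "D \<in> B" "D \<subseteq> E"
    using B(1) E unfolding is_base_def by blast
  then have D: "D \<in> entourages X" "D \<subseteq> E"
      and onto: "(\<lambda>\<xi>. \<xi> D) ` carrier (univ_space X x0) = carrier (chain_space X x0 D)"
    using B unfolding is_base_def by auto
  have fine_step: "P \<eta>"
    if "\<zeta> \<in> carrier (univ_space X x0)" "\<eta> \<in> carrier (univ_space X x0)" "P \<zeta>"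
      "\<alpha> \<in> chains_from x0 D" "\<zeta> D = chain_class D (\<alpha> @ [last \<alpha>])"
      "(last \<alpha>, y) \<in> D" "\<eta> D = chain_class D (\<alpha> @ [y])" for \<zeta> \<eta> \<alpha> y
  proof -
    have "(last \<alpha>, last \<alpha>) \<in> D"
      using entourage_refl[OF X(1) D(1)] chains_from_last[OF D(1) X(2) that(4)] by blast
    then have "(\<zeta> D, \<eta> D) \<in> star x0 D D"
      unfolding that(5,7) using that(4,6) by (intro starI)
    then show ?thesis
      using star_coarse[OF that(1,2) D(1) E D(2) D(2)] step[OF that(1-3)] by blast
  qed
  have class_stutter: "chain_class D \<alpha> = chain_class D (\<alpha> @ [last \<alpha>])" if "\<alpha> \<in> chains_from x0 D" for \<alpha>
    using that homotopic_stutter[of D \<alpha>] entourage_refl[OF X(1) D(1)] chains_from_last[OF D(1) X(2) that]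
    by (simp add: chain_class_eq_iff chains_from_def homotopic_sym)
  have "\<forall>\<xi>\<in>carrier (univ_space X x0). \<xi> D = chain_class D \<alpha> \<longrightarrow> P \<xi>"
    if "\<alpha> \<noteq> []" "\<alpha> \<in> chains_from x0 D" for \<alpha>
    using that
  proof (induction \<alpha> rule: rev_nonempty_induct)
    case (single x)
    then have "x = x0" "[x0] \<in> chains_from x0 D" by (simp_all add: chains_from_def)
    moreover have "univ_base X x0 D = chain_class D [x0]"
      using D(1) by (simp add: univ_base_def)
    moreover have "(x0, x0) \<in> D"
      using entourage_refl[OF X(1) D(1) X(2)] .
    ultimately show ?case
      using fine_step[OF univ_base_in _ base, of _ "[x0]" x0] class_stutter[of "[x0]"]
      by simp
  next
    case (snoc y \<alpha>)
    then have \<alpha>: "\<alpha> \<in> chains_from x0 D" "(last \<alpha>, y) \<in> D"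
      using chains_from_butlast[OF snoc.hyps(1) snoc.prems] by simp_all
    have "chain_class D \<alpha> \<in> (\<lambda>\<xi>. \<xi> D) ` carrier (univ_space X x0)"
      unfolding onto carrier_chain_space using \<alpha>(1) by (rule imageI)
    then obtain \<zeta> where \<zeta>: "\<zeta> \<in> carrier (univ_space X x0)" "\<zeta> D = chain_class D \<alpha>"
      by (elim imageE) simp
    have "P \<zeta>" using snoc.IH[OF \<alpha>(1)] \<zeta> by simp
    then show ?case
      using fine_step[OF \<zeta>(1) _ _ \<alpha>(1) _ \<alpha>(2)] \<zeta>(2) class_stutter[OF \<alpha>(1)] by simp
  qed
  moreover obtain \<alpha> where "\<alpha> \<in> chains_from x0 D" "\<xi> D = chain_class D \<alpha>"
    by (rule univ_rep[OF \<xi> D(1)])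
  moreover from this(1) have "\<alpha> \<noteq> []"
    by (rule chains_from_nonempty)
  ultimately show ?thesis using \<xi> by blast
qed

text \<open>
  The fibres of \<open>Y\<^sub>E \<longrightarrow> Y\<close> are uniformly discrete: appending \<open>z\<close> to a chain depends only on its class.
\<close>

lemma star_same_endpoint:
  assumes "E \<in> entourages Y" "(c, d) \<in> star y0 E E" "(c, d') \<in> star y0 E E" "endpoint d = endpoint d'"
  shows "d = d'"
proof -
  have append_end: "\<exists>\<gamma>. c = chain_class E \<gamma> \<and> d = chain_class E (\<gamma> @ [endpoint d]) \<and>
      (last \<gamma>, endpoint d) \<in> E" if cd: "(c, d) \<in> star y0 E E" for d
  proof -
    obtain \<alpha> y z where *: "\<alpha> \<in> chains_from y0 E" "(last \<alpha>, y) \<in> E" "(last \<alpha>, z) \<in> E" "(y, z) \<in> E"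
        "c = chain_class E (\<alpha> @ [y])" "d = chain_class E (\<alpha> @ [z])"
      using cd by (rule starE)
    from *(1) have "(\<alpha> @ [z], (\<alpha> @ [y]) @ [z]) \<in> homotopic E"
      using homotopic_detour[OF _ *(3,2,4)] by (simp add: chains_from_def)
    then show ?thesis
      using *(4-6) by (intro exI[of _ "\<alpha> @ [y]"]) (simp add: chain_class_eq_iff)
  qed
  obtain \<gamma> where \<gamma>: "c = chain_class E \<gamma>" "d = chain_class E (\<gamma> @ [endpoint d])" "(last \<gamma>, endpoint d) \<in> E"
    using append_end[OF assms(2)] by blast
  obtain \<gamma>' where \<gamma>': "c = chain_class E \<gamma>'" "d' = chain_class E (\<gamma>' @ [endpoint d'])"
    using append_end[OF assms(3)] by blast
  have "(\<gamma>, \<gamma>') \<in> homotopic E"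
    unfolding chain_class_eq_iff[symmetric] using \<gamma>(1) \<gamma>'(1) by (rule trans[OF sym])
  from homotopic_snoc[OF this \<gamma>(3)] have "chain_class E (\<gamma> @ [endpoint d]) = chain_class E (\<gamma>' @ [endpoint d])"
    by (simp add: chain_class_eq_iff)
  then show ?thesis
    using \<gamma>(2) \<gamma>'(2) assms(4) by simp
qed

text \<open>
  At each scale \<open>E\<close> of \<open>Y\<close> two lifts that agree at a point agree at all sufficiently near points,
  since their values lie over the same point of \<open>Y\<close>.
\<close>

lemma is_lift_unique:
  assumes X: "uspace X" "x0 \<in> carrier X" "coverable X x0" and Y: "uspace Y"
    and F: "is_lift X x0 Y y0 f F" and F': "is_lift X x0 Y y0 f F'"
  shows "F = F'"
proof (rule extensionalityI)
  let ?U = "carrier (univ_space X x0)"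
  show "F \<in> extensional ?U" "F' \<in> extensional ?U"
    using F F' by (simp_all add: is_lift_def)
  have maps: "F \<in> ?U \<rightarrow> carrier (univ_space Y y0)" "F' \<in> ?U \<rightarrow> carrier (univ_space Y y0)"
    using F F' by (simp_all add: is_lift_def ucont_def)
  have close: "\<forall>E\<in>entourages Y. \<exists>D\<in>entourages X. \<forall>\<xi>\<in>?U. \<forall>\<eta>\<in>?U.
       (\<xi> D, \<eta> D) \<in> star x0 D D \<longrightarrow> (H \<xi> E, H \<eta> E) \<in> star y0 E E"
    if "is_lift X x0 Y y0 f H" for H
    using that unfolding is_lift_def ucont_univ_iff[OF X(1) Y] by (elim conjE)
  fix \<xi> assume \<xi>: "\<xi> \<in> ?U"
  show "F \<xi> = F' \<xi>"
  proof (rule univ_ext)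
    show "F \<xi> \<in> carrier (univ_space Y y0)" "F' \<xi> \<in> carrier (univ_space Y y0)"
      using maps \<xi> by auto
    fix E assume E: "E \<in> entourages Y"
    obtain D where D: "D \<in> entourages X"
        "\<forall>\<xi>\<in>?U. \<forall>\<eta>\<in>?U. (\<xi> D, \<eta> D) \<in> star x0 D D \<longrightarrow> (F \<xi> E, F \<eta> E) \<in> star y0 E E"
      using close[OF F] E by blast
    obtain D' where D': "D' \<in> entourages X"
        "\<forall>\<xi>\<in>?U. \<forall>\<eta>\<in>?U. (\<xi> D', \<eta> D') \<in> star x0 D' D' \<longrightarrow> (F' \<xi> E, F' \<eta> E) \<in> star y0 E E"
      using close[OF F'] E by blast
    note DD' = entourage_Int[OF D(1) D'(1)]
    have same_end: "endpoint (F \<eta> E) = endpoint (F' \<eta> E)" if \<eta>: "\<eta> \<in> ?U" for \<eta>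
    proof -
      have "univ_cover Y (F \<eta>) = univ_cover Y (F' \<eta>)"
        using F F' \<eta> by (simp add: is_lift_def)
      moreover have "F \<eta> \<in> carrier (univ_space Y y0)" "F' \<eta> \<in> carrier (univ_space Y y0)"
        using maps \<eta> by auto
      ultimately show ?thesis
        using endpoint_univ[OF Y _ E] by metis
    qed
    show "F \<xi> E = F' \<xi> E"
    proof (rule univ_connected[OF X DD' _ _ \<xi>])
      show "F (univ_base X x0) E = F' (univ_base X x0) E"
        using F F' by (simp add: is_lift_def)
      fix \<zeta> \<eta> assume *: "\<zeta> \<in> ?U" "\<eta> \<in> ?U" "F \<zeta> E = F' \<zeta> E"
        "(\<zeta> (D \<inter> D'), \<eta> (D \<inter> D')) \<in> star x0 (D \<inter> D') (D \<inter> D')"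
      have "(\<zeta> D, \<eta> D) \<in> star x0 D D"
        using star_coarse[OF *(1,2) DD' D(1) _ _ *(4)] by blast
      then have "(F \<zeta> E, F \<eta> E) \<in> star y0 E E"
        using D(2) *(1,2) by blast
      moreover have "(\<zeta> D', \<eta> D') \<in> star x0 D' D'"
        using star_coarse[OF *(1,2) DD' D'(1) _ _ *(4)] by blast
      then have "(F \<zeta> E, F' \<eta> E) \<in> star y0 E E"
        unfolding *(3) using D'(2) *(1,2) by blast
      ultimately show "F \<eta> E = F' \<eta> E"
        using star_same_endpoint[OF E] same_end[OF *(2)] by blast
    qed
  qed
qed

lemma ucont_compose:
  assumes "ucont X Y f" "ucont Y Z g"
  shows "ucont X Z (g \<circ> f)"
proof -
  have "map_prod (g \<circ> f) (g \<circ> f) = map_prod g g \<circ> map_prod f f"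
    by auto
  then have "filterlim (map_prod (g \<circ> f) (g \<circ> f)) (unif Z) (unif X)"
    using assms filterlim_compose[of "map_prod g g" "unif Z" "unif Y" "map_prod f f" "unif X"]
    by (simp add: ucont_def comp_def)
  then show ?thesis
    using assms by (auto simp: ucont_def)
qed

lemma the_lift_eq:
  assumes "uspace X" "x0 \<in> carrier X" "coverable X x0" "uspace Y" "is_lift X x0 Y y0 f F"
  shows "the_lift X x0 Y y0 f = F"
  unfolding the_lift_def using assms by (blast intro: is_lift_unique the_equality)

lemma the_lift_lift_map:
  assumes "uspace X" "x0 \<in> carrier X" "coverable X x0" "uspace Y" "ucont X Y f" "f x0 = y0"
  shows "the_lift X x0 Y y0 f = lift_map X x0 Y f"
  using assms by (intro the_lift_eq is_lift_lift_map)

lemma lift_map_compose: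
  assumes X: "uspace X" and Y: "uspace Y" and f: "ucont X Y f" "f x0 = y0"
    and Z: "uspace Z" and g: "ucont Y Z g"
  shows "lift_map X x0 Z (g \<circ> f) = compose (carrier (univ_space X x0)) (lift_map Y y0 Z g) (lift_map X x0 Y f)"
proof (rule extensionalityI)
  fix \<xi> assume \<xi>: "\<xi> \<in> carrier (univ_space X x0)"
  note gf = ucont_compose[OF f(1) g]
  have F\<xi>: "lift_map X x0 Y f \<xi> \<in> carrier (univ_space Y y0)"
    by (rule lift_map_in[OF X f \<xi>])
  have "lift_map X x0 Z (g \<circ> f) \<xi> = lift_map Y y0 Z g (lift_map X x0 Y f \<xi>)"
  proof (rule univ_ext)
    show "lift_map X x0 Z (g \<circ> f) \<xi> \<in> carrier (univ_space Z (g y0))"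
      using lift_map_in[OF X gf refl \<xi>] f(2) by simp
    show "lift_map Y y0 Z g (lift_map X x0 Y f \<xi>) \<in> carrier (univ_space Z (g y0))"
      by (rule lift_map_in[OF Y g refl F\<xi>])
    fix E assume E: "E \<in> entourages Z"
    note C = pullback_entourage[OF Y g E]
    note D = pullback_entourage[OF X f(1) C]
    obtain \<alpha> where \<alpha>: "\<xi> (pullback X f (pullback Y g E)) = chain_class (pullback X f (pullback Y g E)) \<alpha>"
      by (rule univ_rep[OF \<xi> D])
    have "lift_map X x0 Y f \<xi> (pullback Y g E) = chain_class (pullback Y g E) (map f \<alpha>)"
      by (rule lift_map_eq[OF X f(1) \<xi> D C _ \<alpha>]) (auto simp: pullback_def)
    then have "lift_map Y y0 Z g (lift_map X x0 Y f \<xi>) E = chain_class E (map g (map f \<alpha>))"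
      by (rule lift_map_eq[OF Y g F\<xi> C E, rotated]) (auto simp: pullback_def)
    moreover have "lift_map X x0 Z (g \<circ> f) \<xi> E = chain_class E (map (g \<circ> f) \<alpha>)"
      by (rule lift_map_eq[OF X gf \<xi> D E _ \<alpha>]) (auto simp: pullback_def)
    ultimately show "lift_map X x0 Z (g \<circ> f) \<xi> E = lift_map Y y0 Z g (lift_map X x0 Y f \<xi>) E"
      by simp
  qed
  then show "lift_map X x0 Z (g \<circ> f) \<xi> =
      compose (carrier (univ_space X x0)) (lift_map Y y0 Z g) (lift_map X x0 Y f) \<xi>"
    using \<xi> by (simp add: compose_def)
qed (simp_all add: lift_map_def)

section \<open>Lifting chains through a quotient with small kernels\<close>

text \<open>
  The part of a prodiscrete isomorphic action that lifting needs, without the inverse systems: \<open>\<K>\<close>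
  stands for the family of kernels of the projections of the group to its discrete factors.  An
  element that displaces some point by a small amount lies in a given kernel, there are kernels
  with arbitrarily small orbits, and a family of group elements that is compatible modulo the
  kernels has a limit.
\<close>

locale small_kernel_quotient =
  fixes X :: "'a uspace" and x0 :: 'a and Y :: "'b uspace" and y0 :: 'b and f :: "'a \<Rightarrow> 'b"
    and G :: "'g monoid" (structure) and act :: "'g \<Rightarrow> 'a \<Rightarrow> 'a" and \<K> :: "'g set set"
  assumes X: "uspace X" and x0: "x0 \<in> carrier X" and Y: "uspace Y"
    and ucont_f: "ucont X Y f" and f_base: "f x0 = y0"
    and action: "group_action G (carrier X) act"
    and onto: "f ` carrier X = carrier Y"
    and image_entourage: "D \<in> entourages X \<Longrightarrow> map_prod f f ` D \<in> entourages Y"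
    and fibre: "x \<in> carrier X \<Longrightarrow> x' \<in> carrier X \<Longrightarrow> f x = f x' \<longleftrightarrow> (\<exists>g\<in>carrier G. x' = act g x)"
    and invariant_base: "E \<in> entourages X \<Longrightarrow>
      \<exists>D\<in>entourages X. D \<subseteq> E \<and> (\<forall>g\<in>carrier G. \<forall>(x, y)\<in>D. (act g x, act g y) \<in> D)"
    and kernel_subgroup: "K \<in> \<K> \<Longrightarrow> subgroup K G"
    and isolating: "K \<in> \<K> \<Longrightarrow>
      \<exists>E\<in>entourages X. \<forall>g\<in>carrier G. \<forall>x\<in>carrier X. (x, act g x) \<in> E \<longrightarrow> g \<in> K"
    and small: "E \<in> entourages X \<Longrightarrow> \<exists>K\<in>\<K>. \<forall>g\<in>K. \<forall>x\<in>carrier X. (x, act g x) \<in> E"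
    and separated: "g \<in> carrier G \<Longrightarrow> (\<And>K. K \<in> \<K> \<Longrightarrow> g \<in> K) \<Longrightarrow> g = \<one>"
    and complete: "\<gamma> \<in> \<K> \<rightarrow> carrier G \<Longrightarrow>
      (\<And>K L. K \<in> \<K> \<Longrightarrow> L \<in> \<K> \<Longrightarrow> L \<subseteq> K \<Longrightarrow> \<gamma> L \<otimes> inv (\<gamma> K) \<in> K) \<Longrightarrow>
      \<exists>h\<in>carrier G. \<forall>K\<in>\<K>. h \<otimes> inv (\<gamma> K) \<in> K"
begin

interpretation group_action G "carrier X" act
  by (rule action)

lemma group_G: "group G"
  using group_hom by (rule group_hom.axioms)

lemma act_closed: "g \<in> carrier G \<Longrightarrow> x \<in> carrier X \<Longrightarrow> act g x \<in> carrier X"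
  by (rule element_image) auto

lemma act_one [simp]: "x \<in> carrier X \<Longrightarrow> act \<one> x = x"
  using id_eq_one by (metis restrict_apply')

lemma act_mult: "g \<in> carrier G \<Longrightarrow> h \<in> carrier G \<Longrightarrow> x \<in> carrier X \<Longrightarrow> act (g \<otimes> h) x = act g (act h x)"
  by (rule composition_rule)

lemma act_inv: "g \<in> carrier G \<Longrightarrow> x \<in> carrier X \<Longrightarrow> act (inv g) (act g x) = x"
  by (rule orbit_sym_aux) auto

lemma kernel_carrier: "K \<in> \<K> \<Longrightarrow> g \<in> K \<Longrightarrow> g \<in> carrier G"
  using kernel_subgroup subgroup.subset by blast

lemma f_act: "g \<in> carrier G \<Longrightarrow> x \<in> carrier X \<Longrightarrow> f (act g x) = f x"
  using fibre[of x "act g x"] act_closed by auto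

text \<open>
  An element with a fixed point displaces it by less than any entourage, so it lies in every kernel;
  but the kernels intersect trivially.
\<close>

lemma act_free:
  assumes "g \<in> carrier G" "h \<in> carrier G" "x \<in> carrier X" "act g x = act h x"
  shows "g = h"
proof -
  interpret group G by (rule group_G)
  have fixed: "act (inv h \<otimes> g) x = x"
    using assms by (simp add: act_mult act_inv)
  have "inv h \<otimes> g = \<one>"
  proof (rule separated)
    fix K assume "K \<in> \<K>"
    then obtain E where E: "E \<in> entourages X"
        "\<forall>g\<in>carrier G. \<forall>x\<in>carrier X. (x, act g x) \<in> E \<longrightarrow> g \<in> K"
      using isolating by blast
    have "(x, act (inv h \<otimes> g) x) \<in> E"
      unfolding fixed by (rule entourage_refl[OF X E(1) assms(3)])
    moreover have "inv h \<otimes> g \<in> carrier G"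
      using assms(1,2) by simp
    ultimately show "inv h \<otimes> g \<in> K"
      using E(2) assms(3) by blast
  qed (use assms in simp)
  then show ?thesis
    using assms(1,2) by (metis inv_equality inv_inv inv_closed)
qed

text \<open>
  When the lift of a link is compared with the lift of a detour through an inserted point, the ends
  are two points of one fibre joined by three \<open>D\<close>-links; this is why \<open>separates\<close> speaks of the
  threefold composite.  The twofold composite in \<open>fine\<close> bounds the distance of the ends of two links
  that start at a common point.
\<close>

definition separates :: "'g set \<Rightarrow> ('a \<times> 'a) set \<Rightarrow> bool" where
  "separates K D \<longleftrightarrow> D \<in> entourages X \<and> (\<forall>g\<in>carrier G. \<forall>(x, y)\<in>D. (act g x, act g y) \<in> D) \<and>
     (\<forall>g\<in>carrier G. \<forall>x\<in>carrier X. (x, act g x) \<in> D O D O D \<longrightarrow> g \<in> K)"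

definition fine :: "'g set \<Rightarrow> ('a \<times> 'a) set \<Rightarrow> ('a \<times> 'a) set \<Rightarrow> bool" where
  "fine K D E \<longleftrightarrow> separates K D \<and> E \<in> entourages X \<and>
     (\<forall>g\<in>K. \<forall>h\<in>K. \<forall>(x, y)\<in>D O D. (act g x, act h y) \<in> E)"

lemma separates_entourage: "separates K D \<Longrightarrow> D \<in> entourages X"
  by (simp add: separates_def)

lemma separates_below:
  assumes "K \<in> \<K>" "E \<in> entourages X"
  shows "\<exists>D. separates K D \<and> D \<subseteq> E"
proof -
  obtain A where A: "A \<in> entourages X" "\<forall>g\<in>carrier G. \<forall>x\<in>carrier X. (x, act g x) \<in> A \<longrightarrow> g \<in> K"
    using isolating[OF assms(1)] by blast
  obtain C where C: "C \<in> entourages X" "C O C O C O C \<subseteq> A"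
    using entourage_comp4[OF X A(1)] by blast
  obtain D where D: "D \<in> entourages X" "D \<subseteq> C \<inter> E" "\<forall>g\<in>carrier G. \<forall>(x, y)\<in>D. (act g x, act g y) \<in> D"
    using invariant_base[OF entourage_Int[OF C(1) assms(2)]] by blast
  \<comment> \<open>Reflexivity of \<open>C\<close> turns the threefold composite into a part of the fourfold one.\<close>
  have "(x, y) \<in> A" if xy: "(x, y) \<in> D O D O D" for x y
  proof -
    obtain u v where uv: "(x, u) \<in> D" "(u, v) \<in> D" "(v, y) \<in> D"
      using xy by blast
    moreover have "(y, y) \<in> C"
      using entourage_refl[OF X C(1)] entourage_subset[OF D(1)] uv(3) by blast
    ultimately have "(x, y) \<in> C O C O C O C"
      using D(2) by blast
    then show ?thesis using C(2) by blast
  qed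
  with A(2) have "separates K D"
    unfolding separates_def using D(1,3) by blast
  with D(2) show ?thesis by blast
qed

lemma separates_kernel:
  assumes "separates K D" "g \<in> carrier G" "x \<in> carrier X" "(x, act g x) \<in> D O D O D"
  shows "g \<in> K"
  using assms unfolding separates_def by blast

lemma separates_Int:
  assumes "separates K D" "separates L D'"
  shows "separates K (D \<inter> D')"
  unfolding separates_def
proof (intro conjI ballI impI)
  show "D \<inter> D' \<in> entourages X"
    using assms by (simp add: separates_def entourage_Int)
  show "case p of (x, y) \<Rightarrow> (act g x, act g y) \<in> D \<inter> D'" if "g \<in> carrier G" "p \<in> D \<inter> D'" for g p
    using assms that unfolding separates_def by blast
  fix g x assume *: "g \<in> carrier G" "x \<in> carrier X" "(x, act g x) \<in> (D \<inter> D') O (D \<inter> D') O (D \<inter> D')"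
  then have "(x, act g x) \<in> D O D O D" by blast
  then show "g \<in> K" using assms(1) * unfolding separates_def by blast
qed

lemma separates_superset: "separates L D \<Longrightarrow> L \<subseteq> K \<Longrightarrow> separates K D"
  unfolding separates_def by blast

lemma fine_Int: "fine K D E \<Longrightarrow> separates L D' \<Longrightarrow> fine K (D \<inter> D') E"
  unfolding fine_def using separates_Int by blast

lemma fine_superset: "fine K D E \<Longrightarrow> E \<subseteq> E' \<Longrightarrow> E' \<in> entourages X \<Longrightarrow> fine K D E'"
  unfolding fine_def by blast

lemma fine_exists:
  assumes "E \<in> entourages X"
  shows "\<exists>K\<in>\<K>. \<exists>D. fine K D E"
proof -
  obtain A where A: "A \<in> entourages X" "A O A O A O A \<subseteq> E"
    using entourage_comp4[OF X assms] by blast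
  obtain K where K: "K \<in> \<K>" "\<forall>g\<in>K. \<forall>x\<in>carrier X. (x, act g x) \<in> A"
    using small[OF A(1)] by blast
  obtain D where D: "separates K D" "D \<subseteq> A"
    using separates_below[OF K(1) A(1)] by blast
  \<comment> \<open>Of the four factors, two absorb the \<open>D\<close>-links and two the displacements by \<open>g\<close> and \<open>h\<close>.\<close>
  have "(act g x, act h y) \<in> E" if gh: "g \<in> K" "h \<in> K" and xy: "(x, y) \<in> D O D" for g h x y
  proof -
    obtain z where z: "(x, z) \<in> A" "(z, y) \<in> A"
      using xy D(2) by blast
    then have "x \<in> carrier X" "y \<in> carrier X"
      using entourage_subset[OF A(1)] by auto
    then have "(act g x, x) \<in> A" "(y, act h y) \<in> A"
      using K(2) gh entourage_sym[OF A(1)] by simp_all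
    with z A(2) show ?thesis by blast
  qed
  with D(1) assms have "fine K D E"
    unfolding fine_def by blast
  with K(1) show ?thesis by blast
qed

text \<open>With the coarsest target, fineness imposes no condition on the size of the orbits.\<close>

lemma separates_fine:
  assumes "K \<in> \<K>" "separates K D"
  shows "fine K D (carrier X \<times> carrier X)"
proof -
  have "(act g x, act h y) \<in> carrier X \<times> carrier X" if "g \<in> K" "h \<in> K" "(x, y) \<in> D O D" for g h x y
  proof -
    have "x \<in> carrier X" "y \<in> carrier X"
      using that(3) assms(2) entourage_subset[of D X] unfolding separates_def by auto
    then show ?thesis
      using that(1,2) kernel_carrier[OF assms(1)] act_closed by simp
  qed
  then show ?thesis
    unfolding fine_def using assms(2) carrier_entourage[OF X] by blast
qed

lemma fine_entourage:
  assumes "fine K D E"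
  shows "D \<in> entourages X" "E \<in> entourages X"
  using assms by (simp_all add: fine_def separates_def)

lemma fine_close:
  assumes "fine K D E" "(x, z) \<in> D" "(z, y) \<in> D" "g \<in> K" "h \<in> K"
  shows "(act g x, act h y) \<in> E"
proof -
  have "(x, y) \<in> D O D" using assms(2,3) by blast
  then show ?thesis
    using assms(1,4,5) unfolding fine_def by blast
qed

lemma fine_close1:
  assumes "fine K D E" "(x, y) \<in> D" "g \<in> K" "h \<in> K"
  shows "(act g x, act h y) \<in> E"
proof -
  have "(y, y) \<in> D"
    using assms(1,2) entourage_refl[OF X, of D y] entourage_subset[of D X]
    unfolding fine_def separates_def by blast
  then show ?thesis using fine_close[OF assms(1,2) _ assms(3,4)] by blast
qed

lemma fine_orbit:
  assumes "fine K D E" "x \<in> carrier X" "g \<in> K" "h \<in> K"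
  shows "(act g x, act h x) \<in> E"
  using fine_close1[OF assms(1) entourage_refl[OF X fine_entourage(1)[OF assms(1)] assms(2)] assms(3,4)] .

lemma kernel_one: "K \<in> \<K> \<Longrightarrow> \<one> \<in> K"
  using kernel_subgroup by (rule subgroup.one_closed)

lemma fine_subset:
  assumes "K \<in> \<K>" "fine K D E"
  shows "D \<subseteq> E"
proof clarify
  fix x y assume xy: "(x, y) \<in> D"
  then have "x \<in> carrier X" "y \<in> carrier X"
    using entourage_subset[OF fine_entourage(1)[OF assms(2)]] by auto
  then show "(x, y) \<in> E"
    using fine_close1[OF assms(2) xy kernel_one kernel_one] assms(1) by simp
qed

lemma fine_invariant: "fine K D E \<Longrightarrow> g \<in> carrier G \<Longrightarrow> (x, y) \<in> D \<Longrightarrow> (act g x, act g y) \<in> D"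
  unfolding fine_def separates_def by blast

text \<open>
  Two chains in \<open>X\<close> with the same start and the same image need not have the same end; but if their links are fine,
  the ends differ by an element of \<open>K\<close>, hence by one \<open>E\<close>-step.
\<close>

definition same_lift :: "'g set \<Rightarrow> ('a \<times> 'a) set \<Rightarrow> 'a list \<Rightarrow> 'a list \<Rightarrow> bool" where
  "same_lift K E \<alpha> \<beta> \<longleftrightarrow> chain E \<alpha> \<and> chain E \<beta> \<and> last \<alpha> \<in> carrier X \<and>
     (\<exists>k\<in>K. last \<beta> = act k (last \<alpha>)) \<and> (\<alpha> @ [last \<beta>], \<beta>) \<in> homotopic E"

context
  fixes K D E
  assumes K: "K \<in> \<K>" and fine: "fine K D E"
begin

interpretation K: subgroup K G
  by (rule kernel_subgroup[OF K])

lemma D_E: "(x, y) \<in> D \<Longrightarrow> (x, y) \<in> E"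
  using fine_subset[OF K fine] by blast

lemma D_carrier: "(x, y) \<in> D \<Longrightarrow> x \<in> carrier X \<and> y \<in> carrier X"
  using entourage_subset[OF fine_entourage(1)[OF fine]] by blast

lemma E_refl: "x \<in> carrier X \<Longrightarrow> (x, x) \<in> E"
  by (rule entourage_refl[OF X fine_entourage(2)[OF fine]])

lemma E_sym: "(x, y) \<in> E \<Longrightarrow> (y, x) \<in> E"
  by (rule entourage_sym[OF fine_entourage(2)[OF fine]])

lemma D_sym: "(x, y) \<in> D \<Longrightarrow> (y, x) \<in> D"
  by (rule entourage_sym[OF fine_entourage(1)[OF fine]])

lemma orbit_E: "x \<in> carrier X \<Longrightarrow> g \<in> K \<Longrightarrow> (x, act g x) \<in> E"
  using fine_orbit[OF fine _ kernel_one[OF K]] by force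

text \<open>
  Over the same point of \<open>Y\<close>, ends of short paths from \<open>K\<close>-equivalent points are \<open>K\<close>-equivalent: after
  translation by \<open>g\<close> they are joined by three \<open>D\<close>-links, and \<open>D\<close> separates.
\<close>

lemma fibre_close:
  assumes "g \<in> K" "(u, x) \<in> D" "(act g u, w) \<in> D" "(w, x') \<in> D" "f x = f x'"
  shows "\<exists>h\<in>K. x' = act h x"
proof -
  interpret group G by (rule group_G)
  have g: "g \<in> carrier G" using assms(1) K.subset by blast
  have X': "x \<in> carrier X" "x' \<in> carrier X"
    using D_carrier assms(2,4) by blast+
  then obtain h where h: "h \<in> carrier G" "x' = act h x"
    using fibre assms(5) by blast
  have "(act g x, act g u) \<in> D"
    using fine_invariant[OF fine g D_sym[OF assms(2)]] .
  moreover have "act (h \<otimes> inv g) (act g x) = x'"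
    using g h X' by (simp add: act_mult act_closed act_inv)
  ultimately have near: "(act g x, act (h \<otimes> inv g) (act g x)) \<in> D O D O D"
    using assms(3,4) by auto
  have "separates K D"
    using fine by (simp add: fine_def)
  from separates_kernel[OF this _ _ near] have "h \<otimes> inv g \<in> K"
    using g h X' act_closed by simp
  then have "(h \<otimes> inv g) \<otimes> g \<in> K"
    using assms(1) by (rule K.m_closed)
  then have "h \<in> K"
    using g h by (simp add: m_assoc)
  with h(2) show ?thesis by blast
qed

lemma same_lift_refl: "chain E \<alpha> \<Longrightarrow> last \<alpha> \<in> carrier X \<Longrightarrow> same_lift K E \<alpha> \<alpha>"
  unfolding same_lift_def using K.one_closed act_one homotopic_stutter E_refl by metis

lemma same_lift_last:
  assumes "same_lift K E \<alpha> \<beta>"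
  shows "last \<alpha> \<in> carrier X" "last \<beta> \<in> carrier X"
  using assms act_closed K.subset by (auto simp: same_lift_def)

lemma same_lift_sym:
  assumes "same_lift K E \<alpha> \<beta>"
  shows "same_lift K E \<beta> \<alpha>"
proof -
  obtain k where k: "k \<in> K" "last \<beta> = act k (last \<alpha>)"
    using assms by (auto simp: same_lift_def)
  have \<alpha>: "chain E \<alpha>" "chain E \<beta>" "last \<alpha> \<in> carrier X" and hom: "(\<alpha> @ [last \<beta>], \<beta>) \<in> homotopic E"
    using assms by (auto simp: same_lift_def)
  have near: "(last \<alpha>, last \<beta>) \<in> E"
    unfolding k(2) by (rule orbit_E[OF \<alpha>(3) k(1)])
  have "(\<beta> @ [last \<alpha>], (\<alpha> @ [last \<beta>]) @ [last \<alpha>]) \<in> homotopic E"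
    using E_sym[OF near] by (intro homotopic_sym[OF homotopic_snoc[OF hom]]) simp
  also have "((\<alpha> @ [last \<beta>]) @ [last \<alpha>], \<alpha> @ [last \<alpha>]) \<in> homotopic E"
    using homotopic_detour[OF \<alpha>(1) E_refl[OF \<alpha>(3)] near E_sym[OF near]]
    by (simp add: homotopic_sym)
  also have "(\<alpha> @ [last \<alpha>], \<alpha>) \<in> homotopic E"
    by (rule homotopic_stutter[OF \<alpha>(1) E_refl[OF \<alpha>(3)]])
  finally have "(\<beta> @ [last \<alpha>], \<alpha>) \<in> homotopic E" .
  moreover have "last \<alpha> = act (inv k) (last \<beta>)"
    using act_inv[of k "last \<alpha>"] k \<alpha>(3) K.subset by auto
  ultimately show ?thesis
    unfolding same_lift_def using \<alpha> same_lift_last(2)[OF assms] K.m_inv_closed[OF k(1)] by blast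
qed

lemma same_lift_trans:
  assumes "same_lift K E \<alpha> \<beta>" "same_lift K E \<beta> \<gamma>"
  shows "same_lift K E \<alpha> \<gamma>"
proof -
  interpret group G by (rule group_G)
  obtain k where k: "k \<in> K" "last \<beta> = act k (last \<alpha>)"
    using assms(1) by (auto simp: same_lift_def)
  obtain l where l: "l \<in> K" "last \<gamma> = act l (last \<beta>)"
    using assms(2) by (auto simp: same_lift_def)
  have *: "chain E \<alpha>" "chain E \<gamma>" "last \<alpha> \<in> carrier X" "last \<beta> \<in> carrier X"
      and hom: "(\<alpha> @ [last \<beta>], \<beta>) \<in> homotopic E" "(\<beta> @ [last \<gamma>], \<gamma>) \<in> homotopic E"
    using assms by (auto simp: same_lift_def)
  have lk: "last \<gamma> = act (l \<otimes> k) (last \<alpha>)"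
    using k l *(3) K.subset act_mult by auto
  have near: "(last \<alpha>, last \<beta>) \<in> E" "(last \<beta>, last \<gamma>) \<in> E" "(last \<alpha>, last \<gamma>) \<in> E"
    using orbit_E[OF *(3) k(1)] orbit_E[OF *(4) l(1)] orbit_E[OF *(3) K.m_closed[OF l(1) k(1)]]
    by (simp_all only: k(2)[symmetric] l(2)[symmetric] lk[symmetric])
  have "(\<alpha> @ [last \<gamma>], (\<alpha> @ [last \<beta>]) @ [last \<gamma>]) \<in> homotopic E"
    using homotopic_detour[OF *(1) near(3,1,2)] by simp
  also have "((\<alpha> @ [last \<beta>]) @ [last \<gamma>], \<beta> @ [last \<gamma>]) \<in> homotopic E"
    using near(2) by (intro homotopic_snoc[OF hom(1)]) simp
  also note hom(2)
  finally show ?thesis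
    unfolding same_lift_def using * lk K.m_closed[OF l(1) k(1)] by blast
qed

text \<open>
  The last points \<open>x\<close> and \<open>act h x\<close> are close, so the correction of the end by an orbit step can be moved
  past a further link.
\<close>

lemma same_lift_append:
  assumes "same_lift K E \<alpha> \<beta>" "(last \<alpha>, x) \<in> D" "h \<in> K"
  shows "same_lift K E (\<alpha> @ [x]) (\<beta> @ [act h x])"
proof -
  obtain k where k: "k \<in> K" "last \<beta> = act k (last \<alpha>)"
    using assms(1) by (auto simp: same_lift_def)
  have *: "chain E \<alpha>" "chain E \<beta>" "last \<alpha> \<in> carrier X"
      and hom: "(\<alpha> @ [last \<beta>], \<beta>) \<in> homotopic E"
    using assms(1) by (auto simp: same_lift_def)
  have ne: "\<alpha> \<noteq> []" "\<beta> \<noteq> []" using *(1,2) chain_nonempty by blast+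
  have x: "x \<in> carrier X" using D_carrier[OF assms(2)] by simp
  have near: "(last \<alpha>, x) \<in> E" "(x, act h x) \<in> E" "(last \<alpha>, last \<beta>) \<in> E"
    using D_E[OF assms(2)] orbit_E[OF x assms(3)] orbit_E[OF *(3) k(1)] k(2) by simp_all
  have near': "(last \<alpha>, act h x) \<in> E" "(last \<beta>, act h x) \<in> E"
    using fine_close1[OF fine assms(2) K.one_closed assms(3)] *(3)
      fine_close1[OF fine assms(2) k(1) assms(3)] k(2) by simp_all
  have "((\<alpha> @ [x]) @ [act h x], \<alpha> @ [act h x]) \<in> homotopic E"
    using homotopic_detour[OF *(1) near'(1) near(1,2)] by (simp add: homotopic_sym)
  also have "(\<alpha> @ [act h x], (\<alpha> @ [last \<beta>]) @ [act h x]) \<in> homotopic E"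
    using homotopic_detour[OF *(1) near'(1) near(3) near'(2)] by simp
  also have "((\<alpha> @ [last \<beta>]) @ [act h x], \<beta> @ [act h x]) \<in> homotopic E"
    using near'(2) by (intro homotopic_snoc[OF hom]) simp
  finally show ?thesis
    unfolding same_lift_def using * ne x near near' assms(3) by (auto simp: chain_snoc)
qed

lemma same_lift_snoc:
  assumes "same_lift K E \<alpha> \<beta>" "(last \<alpha>, x) \<in> D" "(last \<beta>, x') \<in> D" "f x = f x'"
  shows "same_lift K E (\<alpha> @ [x]) (\<beta> @ [x'])"
proof -
  obtain k where k: "k \<in> K" "last \<beta> = act k (last \<alpha>)"
    using assms(1) by (auto simp: same_lift_def)
  have "(x', x') \<in> D"
    using entourage_refl[OF X fine_entourage(1)[OF fine]] D_carrier[OF assms(3)] by blast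
  then obtain h where "h \<in> K" "x' = act h x"
    using fibre_close[OF k(1) assms(2) assms(3)[unfolded k(2)] _ assms(4)] by blast
  then show ?thesis
    using same_lift_append[OF assms(1,2)] by blast
qed

text \<open>
  A point is inserted between two others in the base: the lift that passes through \<open>b\<close> may
  arrive at another point of the fibre than the direct link does.
\<close>

lemma same_lift_detour:
  assumes "same_lift K E \<alpha> \<beta>" "(last \<alpha>, x) \<in> D" "(last \<beta>, b) \<in> D" "(b, x') \<in> D" "f x = f x'"
  shows "same_lift K E (\<alpha> @ [x]) (\<beta> @ [b, x'])"
proof -
  obtain k where k: "k \<in> K" "last \<beta> = act k (last \<alpha>)"
    using assms(1) by (auto simp: same_lift_def)
  obtain h where h: "h \<in> K" "x' = act h x"
    using fibre_close[OF k(1) assms(2) assms(3)[unfolded k(2)] assms(4,5)] by blast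
  have first: "same_lift K E (\<alpha> @ [x]) (\<beta> @ [x'])"
    using same_lift_append[OF assms(1,2) h(1)] h(2) by simp
  have \<beta>: "chain E \<beta>" using assms(1) by (simp add: same_lift_def)
  then have "\<beta> \<noteq> []" by (rule chain_nonempty)
  have ch: "chain E (\<beta> @ [x'])" using first by (simp add: same_lift_def)
  then have near: "(last \<beta>, x') \<in> E" using \<open>\<beta> \<noteq> []\<close> by (simp add: chain_snoc)
  have x': "x' \<in> carrier X" using D_carrier[OF assms(4)] by simp
  have "((\<beta> @ [x']) @ [x'], \<beta> @ [x']) \<in> homotopic E"
    using homotopic_stutter[OF ch] E_refl[OF x'] by simp
  also have "(\<beta> @ [x'], \<beta> @ [b, x']) \<in> homotopic E"
    by (rule homotopic_detour[OF \<beta> near D_E[OF assms(3)] D_E[OF assms(4)]])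
  finally have hom: "((\<beta> @ [x']) @ [x'], \<beta> @ [b, x']) \<in> homotopic E" .
  have "chain E (\<beta> @ [b, x'])"
    using homotopic_chain[OF homotopic_detour[OF \<beta> near D_E[OF assms(3)] D_E[OF assms(4)]] ch] .
  moreover have "\<exists>k\<in>K. x' = act k x'"
    using x' K.one_closed by (intro bexI[of _ \<one>]) simp_all
  ultimately have "same_lift K E (\<beta> @ [x']) (\<beta> @ [b, x'])"
    unfolding same_lift_def using ch x' hom by simp
  with first show ?thesis by (rule same_lift_trans)
qed

lemma same_lift_stutter:
  assumes "same_lift K E \<alpha> \<beta>" "(last \<beta>, b) \<in> D" "f b = f (last \<beta>)"
  shows "same_lift K E \<alpha> (\<beta> @ [b])"
proof -
  have \<beta>: "chain E \<beta>" "last \<beta> \<in> carrier X"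
    using assms(1) same_lift_last(2)[OF assms(1)] by (simp_all add: same_lift_def)
  then have ne: "\<beta> \<noteq> []" using chain_nonempty by blast
  have refl: "(last \<beta>, last \<beta>) \<in> D" "(b, b) \<in> D"
    using D_carrier[OF assms(2)] by (simp_all add: entourage_refl[OF X fine_entourage(1)[OF fine]])
  have "(act \<one> (last \<beta>), b) \<in> D"
    using assms(2) \<beta>(2) by simp
  from fibre_close[OF K.one_closed refl(1) this refl(2) assms(3)[symmetric]]
  obtain h where h: "h \<in> K" "b = act h (last \<beta>)" by blast
  have "same_lift K E \<beta> (\<beta> @ [b])"
    unfolding same_lift_def using \<beta> ne h D_E[OF assms(2)] by (auto simp: chain_snoc)
  with assms(1) show ?thesis by (rule same_lift_trans)
qed

lemma same_lift_extend:
  assumes "same_lift K E \<alpha> \<beta>" "map f \<delta> = map f \<epsilon>" "chain D (last \<alpha> # \<delta>)" "chain D (last \<beta> # \<epsilon>)"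
  shows "same_lift K E (\<alpha> @ \<delta>) (\<beta> @ \<epsilon>)"
  using assms
proof (induction \<delta> arbitrary: \<alpha> \<beta> \<epsilon>)
  case Nil
  then show ?case by simp
next
  case (Cons x \<delta>)
  then obtain x' \<epsilon>' where \<epsilon>: "\<epsilon> = x' # \<epsilon>'" "f x = f x'" "map f \<delta> = map f \<epsilon>'"
    by (cases \<epsilon>) auto
  have "(last \<alpha>, x) \<in> D" "(last \<beta>, x') \<in> D" and ch: "chain D (x # \<delta>)" "chain D (x' # \<epsilon>')"
    using Cons.prems(3,4) \<epsilon>(1) by (simp_all add: chain_Cons)
  then have "same_lift K E (\<alpha> @ [x]) (\<beta> @ [x'])"
    using same_lift_snoc[OF Cons.prems(1)] \<epsilon>(2) by blast
  from Cons.IH[OF this \<epsilon>(3)] ch show ?case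
    unfolding \<epsilon>(1) by simp
qed

lemma same_lift_same_image:
  assumes "\<alpha> \<in> chains_from x0 D" "\<beta> \<in> chains_from x0 D" "map f \<alpha> = map f \<beta>"
  shows "same_lift K E \<alpha> \<beta>"
proof -
  have "\<alpha> = x0 # tl \<alpha>" "\<beta> = x0 # tl \<beta>"
    using assms(1,2) chains_from_nonempty by (metis (lifting) chains_from_def list.collapse mem_Collect_eq)+
  then obtain \<delta> \<epsilon> where *: "\<alpha> = [x0] @ \<delta>" "\<beta> = [x0] @ \<epsilon>" by auto
  show ?thesis
    unfolding * using assms unfolding *
    by (intro same_lift_extend same_lift_refl) (simp_all add: x0 chains_from_def)
qed

lemma same_lift_insert:
  assumes "\<alpha> \<in> chains_from x0 D" "\<beta> \<in> chains_from x0 D" "(map f \<alpha>, map f \<beta>) \<in> insert_step C"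
  shows "same_lift K E \<alpha> \<beta>"
proof -
  obtain as bs a where st: "map f \<alpha> = as @ bs" "map f \<beta> = as @ a # bs"
      "hd (map f \<alpha>) = hd (map f \<beta>)" "last (map f \<alpha>) = last (map f \<beta>)"
    using assms(3) by (rule insert_stepE)
  obtain \<alpha>1 \<alpha>2 where \<alpha>: "\<alpha> = \<alpha>1 @ \<alpha>2" "map f \<alpha>1 = as" "map f \<alpha>2 = bs"
    using st(1) unfolding map_eq_append_conv by blast
  obtain \<beta>1 b \<beta>2 where \<beta>: "\<beta> = \<beta>1 @ b # \<beta>2" "map f \<beta>1 = as" "f b = a" "map f \<beta>2 = bs"
    using st(2) unfolding map_eq_append_conv map_eq_Cons_conv by blast
  have ch\<alpha>: "chain D \<alpha>" "hd \<alpha> = x0" "\<alpha> \<noteq> []" and ch\<beta>: "chain D \<beta>" "hd \<beta> = x0" "\<beta> \<noteq> []"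
    using assms(1,2) by (auto simp: chains_from_def dest: chain_nonempty)
  show ?thesis
  proof (cases "as = []")
    \<comment> \<open>A point inserted in front equals the old first point \<open>y0\<close>, so its lift \<open>x0\<close> is the start of \<open>\<beta>\<close>.\<close>
    case True
    then have one: "\<alpha>1 = []" "\<beta>1 = []" using \<alpha>(2) \<beta>(2) by auto
    then obtain \<delta> where \<delta>: "\<alpha> = [x0] @ \<delta>"
      using ch\<alpha> \<alpha>(1) by (cases \<alpha>) auto
    obtain c' \<epsilon> where \<epsilon>: "\<beta>2 = c' # \<epsilon>" "f c' = f x0" "map f \<epsilon> = map f \<delta>"
      using \<delta> \<alpha> one \<beta> by (cases \<beta>2) auto
    have \<beta>_eq: "\<beta> = ([x0] @ [c']) @ \<epsilon>"
      using \<beta>(1) one \<epsilon>(1) ch\<beta>(2) by simp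
    have "(x0, c') \<in> D" and ch: "chain D (x0 # \<delta>)" "chain D (c' # \<epsilon>)"
      using ch\<alpha>(1) ch\<beta>(1) \<delta> \<beta>_eq by (simp_all add: chain_Cons)
    then have "same_lift K E [x0] ([x0] @ [c'])"
      using same_lift_stutter[of "[x0]" "[x0]" c'] same_lift_refl[of "[x0]"] \<epsilon>(2) x0 by simp
    then show ?thesis
      unfolding \<delta> \<beta>_eq by (rule same_lift_extend) (use ch \<epsilon>(3) in simp_all)
  next
    case False
    then have ne: "\<alpha>1 \<noteq> []" "\<beta>1 \<noteq> []" using \<alpha>(2) \<beta>(2) by auto
    have ch\<beta>': "chain D \<beta>1" "chain D (b # \<beta>2)" "(last \<beta>1, b) \<in> D"
      using ch\<beta>(1) ne by (simp_all add: \<beta>(1) chain_append)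
    have "chain D \<alpha>1"
      using ch\<alpha>(1) ne by (cases "\<alpha>2 = []") (simp_all add: \<alpha>(1) chain_append)
    then have start: "same_lift K E \<alpha>1 \<beta>1"
      using ch\<beta>' ch\<alpha>(2) ch\<beta>(2) ne \<alpha> \<beta>
      by (intro same_lift_same_image) (simp_all add: chains_from_def)
    show ?thesis
    proof (cases \<alpha>2)
      \<comment> \<open>A point appended at the end repeats the last point, so its lift stays in the fibre.\<close>
      case Nil
      then have "\<beta>2 = []" using \<alpha>(3) \<beta>(4) by simp
      have "f (last \<alpha>1) = f b"
        using st(4) ch\<alpha>(3) ch\<beta>(3) by (simp add: last_map \<alpha>(1) \<beta>(1) Nil \<open>\<beta>2 = []\<close>)
      moreover have "f (last \<alpha>1) = f (last \<beta>1)"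
        using \<alpha>(2) \<beta>(2) ne by (metis last_map)
      ultimately show ?thesis
        using same_lift_stutter[OF start ch\<beta>'(3)] by (simp add: \<alpha>(1) \<beta>(1) Nil \<open>\<beta>2 = []\<close>)
    next
      case (Cons c \<delta>)
      then obtain c' \<epsilon> where \<epsilon>: "\<beta>2 = c' # \<epsilon>" "f c = f c'" "map f \<delta> = map f \<epsilon>"
        using \<alpha>(3) \<beta>(4) by (cases \<beta>2) auto
      have "(last \<alpha>1, c) \<in> D" "(b, c') \<in> D" and ch: "chain D (c # \<delta>)" "chain D (c' # \<epsilon>)"
        using ch\<alpha>(1) ch\<beta>'(2) ne by (simp_all add: \<alpha>(1) Cons \<epsilon>(1) chain_append chain_Cons)
      then have "same_lift K E (\<alpha>1 @ [c]) (\<beta>1 @ [b, c'])"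
        using same_lift_detour[OF start _ ch\<beta>'(3)] \<epsilon>(2) by blast
      then have "same_lift K E ((\<alpha>1 @ [c]) @ \<delta>) ((\<beta>1 @ [b, c']) @ \<epsilon>)"
        by (rule same_lift_extend) (use ch \<epsilon>(3) in simp_all)
      then show ?thesis by (simp add: \<alpha>(1) \<beta>(1) Cons \<epsilon>(1))
    qed
  qed
qed

end

text \<open>
  A link of the image entourage comes from some \<open>D\<close>-link; invariance of \<open>D\<close> allows to translate that
  link to the point where the lift constructed so far ends.
\<close>

lemma chain_lift:
  assumes "D \<in> entourages X" "\<forall>g\<in>carrier G. \<forall>(x, y)\<in>D. (act g x, act g y) \<in> D"
    and "c \<in> chains_from y0 (map_prod f f ` D)"
  shows "\<exists>\<alpha>\<in>chains_from x0 D. map f \<alpha> = c"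
  using chains_from_nonempty[OF assms(3)] assms(3)
proof (induction c rule: rev_nonempty_induct)
  case (single y)
  then show ?case
    using f_base by (intro bexI[of _ "[x0]"]) (simp_all add: chains_from_def)
next
  case (snoc y c)
  have c: "c \<in> chains_from y0 (map_prod f f ` D)" "(last c, y) \<in> map_prod f f ` D"
    using chains_from_butlast[OF snoc.hyps(1) snoc.prems] by simp_all
  obtain \<alpha> where \<alpha>: "\<alpha> \<in> chains_from x0 D" "map f \<alpha> = c"
    using snoc.IH[OF c(1)] by blast
  have "\<alpha> \<noteq> []" using \<alpha>(2) snoc.hyps(1) by auto
  then have last: "last c = f (last \<alpha>)" using \<alpha>(2) by (auto simp: last_map)
  obtain u v where uv: "(u, v) \<in> D" "last c = f u" "y = f v"
    using c(2) by auto
  have carr: "u \<in> carrier X" "v \<in> carrier X" "last \<alpha> \<in> carrier X"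
    using uv(1) entourage_subset[OF assms(1)] chains_from_last[OF assms(1) x0 \<alpha>(1)] by auto
  then obtain g where g: "g \<in> carrier G" "last \<alpha> = act g u"
    using fibre[of u "last \<alpha>"] uv(2) last by auto
  have "(last \<alpha>, act g v) \<in> D"
    using assms(2) g uv(1) by auto
  then show ?case
    using chains_from_snoc[OF \<alpha>(1)] \<alpha>(2) f_act[OF g(1) carr(2)] uv(3)
    by (intro bexI[of _ "\<alpha> @ [act g v]"]) simp_all
qed

text \<open>
  This is the lifting of homotopies: the intermediate chains lift, and one move in the base changes
  a lift only by an \<open>E\<close>-homotopy and a displacement in \<open>K\<close>.
\<close>

lemma same_lift_homotopic:
  assumes K: "K \<in> \<K>" and fine: "fine K D E"
    and "\<alpha> \<in> chains_from x0 D" "\<beta> \<in> chains_from x0 D"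
    and hom: "(map f \<alpha>, map f \<beta>) \<in> homotopic (map_prod f f ` D)"
  shows "same_lift K E \<alpha> \<beta>"
proof -
  note lift = chain_lift[of D]
  have D: "D \<in> entourages X" "\<forall>g\<in>carrier G. \<forall>(x, y)\<in>D. (act g x, act g y) \<in> D"
    using fine unfolding fine_def separates_def by blast+
  have "map f \<alpha> \<in> chains_from y0 (map_prod f f ` D)"
    using chains_from_map[OF _ assms(3), of f "map_prod f f ` D"] f_base by force
  have "map f \<beta> \<in> chains_from y0 (map_prod f f ` D) \<and>
      (\<forall>\<gamma>\<in>chains_from x0 D. map f \<gamma> = map f \<beta> \<longrightarrow> same_lift K E \<alpha> \<gamma>)"
    using hom
  proof (induction rule: homotopic_induct)
    case refl
    then show ?case
      using \<open>map f \<alpha> \<in> _\<close> same_lift_same_image[OF K fine assms(3)] by simp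
  next
    case (insert us vs)
    obtain \<gamma>' where \<gamma>': "\<gamma>' \<in> chains_from x0 D" "map f \<gamma>' = us"
      using lift[OF D] insert(1) by blast
    have "vs \<in> chains_from y0 (map_prod f f ` D)"
      using chains_from_homotopic[OF _ insert_step_homotopic[OF insert(2)]] insert(1) by blast
    moreover have "same_lift K E \<alpha> \<gamma>" if "\<gamma> \<in> chains_from x0 D" "map f \<gamma> = vs" for \<gamma>
      using same_lift_insert[OF K fine \<gamma>'(1) that(1)] insert \<gamma>' that(2)
        same_lift_trans[OF K fine, of \<alpha> \<gamma>' \<gamma>] by simp
    ultimately show ?case by blast
  next
    case (remove us vs)
    obtain \<gamma>' where \<gamma>': "\<gamma>' \<in> chains_from x0 D" "map f \<gamma>' = us"
      using lift[OF D] remove(1) by blast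
    have "vs \<in> chains_from y0 (map_prod f f ` D)"
      using chains_from_homotopic[OF _ homotopic_sym[OF insert_step_homotopic[OF remove(2)]]] remove(1) by blast
    moreover have "same_lift K E \<alpha> \<gamma>" if "\<gamma> \<in> chains_from x0 D" "map f \<gamma> = vs" for \<gamma>
      using same_lift_insert[OF K fine that(1) \<gamma>'(1)] remove \<gamma>' that(2)
        same_lift_trans[OF K fine, of \<alpha> \<gamma>' \<gamma>] same_lift_sym[OF K fine, of \<gamma> \<gamma>'] by simp
    ultimately show ?case by blast
  qed
  then show ?thesis using assms(4) by blast
qed

end

section \<open>The lift of a cover\<close>

context small_kernel_quotient
begin

interpretation group_action G "carrier X" act
  by (rule action)

abbreviation "UX \<equiv> carrier (univ_space X x0)"
abbreviation "UY \<equiv> carrier (univ_space Y y0)"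
abbreviation "F \<equiv> lift_map X x0 Y f"

lemma lift_in: "\<xi> \<in> UX \<Longrightarrow> F \<xi> \<in> UY"
  by (rule lift_map_in[OF X ucont_f f_base])

lemma map_in_image: "\<forall>(x, y)\<in>D. (f x, f y) \<in> map_prod f f ` D"
  by force

lemma lift_image:
  assumes "\<xi> \<in> UX" "D \<in> entourages X" "\<xi> D = chain_class D \<alpha>"
  shows "F \<xi> (map_prod f f ` D) = chain_class (map_prod f f ` D) (map f \<alpha>)"
  by (rule lift_map_eq[OF X ucont_f assms(1,2) image_entourage[OF assms(2)] map_in_image assms(3)])

lemma homotopic_stutter_end:
  assumes "\<alpha> \<in> chains_from x0 E" "E \<in> entourages X"
  shows "(\<alpha> @ [last \<alpha>], \<alpha>) \<in> homotopic E"
  using homotopic_stutter[of E \<alpha>] entourage_refl[OF X assms(2) chains_from_last[OF assms(2) x0 assms(1)]]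
    assms(1) by (simp add: chains_from_def)

text \<open>
  Representatives of points with the same image are lifts of homotopic chains.  Their ends do not
  depend on the scale and differ by an element of every kernel, hence agree; so no correction of
  the end is left in \<open>same_lift\<close>.
\<close>

lemma lift_inj: "inj_on F UX"
proof (rule inj_onI)
  fix \<xi> \<eta> assume \<xi>: "\<xi> \<in> UX" and \<eta>: "\<eta> \<in> UX" and eq: "F \<xi> = F \<eta>"
  have same: "\<exists>\<alpha> \<beta>. same_lift K E \<alpha> \<beta> \<and> \<alpha> \<in> chains_from x0 D \<and> \<xi> D = chain_class D \<alpha> \<and> \<eta> D = chain_class D \<beta>"
    if K: "K \<in> \<K>" and fine: "fine K D E" for K D E
  proof -
    note D = fine_entourage(1)[OF fine]
    obtain \<alpha> where \<alpha>: "\<alpha> \<in> chains_from x0 D" "\<xi> D = chain_class D \<alpha>"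
      by (rule univ_rep[OF \<xi> D])
    obtain \<beta> where \<beta>: "\<beta> \<in> chains_from x0 D" "\<eta> D = chain_class D \<beta>"
      by (rule univ_rep[OF \<eta> D])
    have "(map f \<alpha>, map f \<beta>) \<in> homotopic (map_prod f f ` D)"
      using lift_image[OF \<xi> D \<alpha>(2)] lift_image[OF \<eta> D \<beta>(2)] eq
      by (simp add: chain_class_eq_iff[symmetric])
    then show ?thesis
      using same_lift_homotopic[OF K fine \<alpha>(1) \<beta>(1)] \<alpha> \<beta> by blast
  qed
  have ends: "\<exists>k\<in>K. univ_cover X \<eta> = act k (univ_cover X \<xi>)" if K: "K \<in> \<K>" for K
  proof -
    obtain D where "separates K D"
      using separates_below[OF K carrier_entourage[OF X]] by blast
    then have fine: "fine K D (carrier X \<times> carrier X)"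
      by (rule separates_fine[OF K])
    note D = fine_entourage(1)[OF fine]
    obtain \<alpha> \<beta> where *: "same_lift K (carrier X \<times> carrier X) \<alpha> \<beta>"
        "\<xi> D = chain_class D \<alpha>" "\<eta> D = chain_class D \<beta>"
      using same[OF K fine] by blast
    then show ?thesis
      unfolding univ_cover_eq[OF X \<xi> D *(2)] univ_cover_eq[OF X \<eta> D *(3)]
      by (simp add: same_lift_def)
  qed
  have x: "univ_cover X \<xi> \<in> carrier X"
    by (rule univ_cover_in[OF X x0 \<xi>])
  obtain K0 where K0: "K0 \<in> \<K>"
    using small[OF carrier_entourage[OF X]] by blast
  obtain g where g: "g \<in> K0" "univ_cover X \<eta> = act g (univ_cover X \<xi>)"
    using ends[OF K0] by blast
  have gG: "g \<in> carrier G" by (rule kernel_carrier[OF K0 g(1)])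
  have "g = \<one>"
  proof (rule separated[OF gG])
    fix K assume K: "K \<in> \<K>"
    obtain k where k: "k \<in> K" "univ_cover X \<eta> = act k (univ_cover X \<xi>)"
      using ends[OF K] by blast
    have "g = k"
      using act_free[OF gG kernel_carrier[OF K k(1)] x] g(2) k(2) by simp
    with k(1) show "g \<in> K" by simp
  qed
  then have same_end: "univ_cover X \<eta> = univ_cover X \<xi>"
    using g(2) x by simp
  show "\<xi> = \<eta>"
  proof (rule univ_ext[OF \<xi> \<eta>])
    fix E assume E: "E \<in> entourages X"
    obtain K D where K: "K \<in> \<K>" and fine: "fine K D E"
      using fine_exists[OF E] by blast
    note D = fine_entourage(1)[OF fine]
    obtain \<alpha> \<beta> where *: "same_lift K E \<alpha> \<beta>" "\<alpha> \<in> chains_from x0 D"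
        "\<xi> D = chain_class D \<alpha>" "\<eta> D = chain_class D \<beta>"
      using same[OF K fine] by blast
    have "last \<beta> = last \<alpha>"
      using univ_cover_eq[OF X \<xi> D *(3)] univ_cover_eq[OF X \<eta> D *(4)] same_end by simp
    then have "(\<alpha> @ [last \<alpha>], \<beta>) \<in> homotopic E"
      using *(1) by (simp add: same_lift_def)
    with homotopic_stutter_end[OF chains_from_mono[OF fine_subset[OF K fine] *(2)] E]
    have "(\<alpha>, \<beta>) \<in> homotopic E"
      by (rule homotopic_trans[OF homotopic_sym])
    then show "\<xi> E = \<eta> E"
      using univ_coarse[OF \<xi> D E fine_subset[OF K fine] *(3)]
        univ_coarse[OF \<eta> D E fine_subset[OF K fine] *(4)]
      by (simp add: chain_class_eq_iff)
  qed
qed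

text \<open>
  Points of \<open>Y~\<close> that are close are represented by chains with the same initial part \<open>c\<close>.  With a lift
  \<open>\<alpha>\<close> of \<open>c\<close> and lifts \<open>a\<close>, \<open>b\<close> of the two last links from its end, their preimages are represented at
  the scale \<open>E\<close> by \<open>\<alpha>, a, act k a\<close> and \<open>\<alpha>, b, act l b\<close> with \<open>k, l\<close> in \<open>K\<close>, and the last points of these are
  close.
\<close>

lemma lift_inverse_ucont:
  assumes E: "E \<in> entourages X"
  shows "\<exists>C\<in>entourages Y. \<forall>\<xi>\<in>UX. \<forall>\<eta>\<in>UX. (F \<xi> C, F \<eta> C) \<in> star y0 C C \<longrightarrow> (\<xi> E, \<eta> E) \<in> star x0 E E"
proof -
  obtain K D where K: "K \<in> \<K>" and fine: "fine K D E"
    using fine_exists[OF E] by blast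
  note D = fine_entourage(1)[OF fine] and DE = fine_subset[OF K fine]
  let ?C = "map_prod f f ` D"
  have inv: "\<forall>g\<in>carrier G. \<forall>(x, y)\<in>D. (act g x, act g y) \<in> D"
    using fine unfolding fine_def separates_def by blast
  have end_rep: "\<exists>k\<in>K. \<zeta> E = chain_class E (\<alpha> @ [a] @ [act k a])"
    if \<zeta>: "\<zeta> \<in> UX" and \<alpha>: "\<alpha> @ [a] \<in> chains_from x0 D"
      and eq: "F \<zeta> ?C = chain_class ?C (map f (\<alpha> @ [a]))" for \<zeta> \<alpha> a
  proof -
    obtain \<beta> where \<beta>: "\<beta> \<in> chains_from x0 D" "\<zeta> D = chain_class D \<beta>"
      by (rule univ_rep[OF \<zeta> D])
    have "(map f (\<alpha> @ [a]), map f \<beta>) \<in> homotopic ?C"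
      using lift_image[OF \<zeta> D \<beta>(2)] eq by (simp add: chain_class_eq_iff[symmetric])
    then have same: "same_lift K E (\<alpha> @ [a]) \<beta>"
      by (rule same_lift_homotopic[OF K fine \<alpha> \<beta>(1)])
    then obtain k where "k \<in> K" "last \<beta> = act k a"
      by (auto simp: same_lift_def)
    moreover have "\<zeta> E = chain_class E ((\<alpha> @ [a]) @ [last \<beta>])"
      using univ_coarse[OF \<zeta> D E DE \<beta>(2)] same homotopic_sym[of "(\<alpha> @ [a]) @ [last \<beta>]" \<beta> E]
      by (simp add: same_lift_def chain_class_eq_iff)
    ultimately show ?thesis by auto
  qed
  have "(\<xi> E, \<eta> E) \<in> star x0 E E"
    if \<xi>: "\<xi> \<in> UX" and \<eta>: "\<eta> \<in> UX" and near: "(F \<xi> ?C, F \<eta> ?C) \<in> star y0 ?C ?C" for \<xi> \<eta>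
  proof -
    obtain c y z where c: "c \<in> chains_from y0 ?C" "(last c, y) \<in> ?C" "(last c, z) \<in> ?C" "(y, z) \<in> ?C"
        "F \<xi> ?C = chain_class ?C (c @ [y])" "F \<eta> ?C = chain_class ?C (c @ [z])"
      using near by (rule starE)
    obtain \<alpha>a where \<alpha>a: "\<alpha>a \<in> chains_from x0 D" "map f \<alpha>a = c @ [y]"
      using chain_lift[OF D inv chains_from_snoc[OF c(1,2)]] by blast
    obtain \<alpha> a where \<alpha>: "\<alpha>a = \<alpha> @ [a]" "map f \<alpha> = c" "f a = y"
      using \<alpha>a(2) unfolding map_eq_append_conv by auto
    have "\<alpha> \<noteq> []" using \<alpha>(2) chains_from_nonempty[OF c(1)] by auto
    then have \<alpha>': "\<alpha> \<in> chains_from x0 D" "(last \<alpha>, a) \<in> D"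
      using chains_from_butlast[OF _ \<alpha>a(1)[unfolded \<alpha>(1)]] by simp_all
    have carr: "last \<alpha> \<in> carrier X" by (rule chains_from_last[OF D x0 \<alpha>'(1)])
    obtain u v where uv: "(u, v) \<in> D" "f (last \<alpha>) = f u" "z = f v"
      using c(3) \<open>\<alpha> \<noteq> []\<close> by (auto simp: \<alpha>(2)[symmetric] last_map)
    have uv': "u \<in> carrier X" "v \<in> carrier X"
      using uv(1) entourage_subset[OF D] by auto
    obtain g where g: "g \<in> carrier G" "last \<alpha> = act g u"
      using fibre[OF uv'(1) carr] uv(2) by auto
    define b where "b = act g v"
    have b: "(last \<alpha>, b) \<in> D" "f b = z"
      unfolding b_def using inv g uv f_act[OF g(1) uv'(2)] by auto
    have \<alpha>b: "\<alpha> @ [b] \<in> chains_from x0 D" by (rule chains_from_snoc[OF \<alpha>'(1) b(1)])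
    obtain k where k: "k \<in> K" "\<xi> E = chain_class E (\<alpha> @ [a] @ [act k a])"
      using end_rep[OF \<xi>, of \<alpha> a] \<alpha>a \<alpha>(1) c(5) by auto
    obtain l where l: "l \<in> K" "\<eta> E = chain_class E (\<alpha> @ [b] @ [act l b])"
      using end_rep[OF \<eta> \<alpha>b] c(6) b(2) \<alpha>(2) by auto
    have ab: "(a, last \<alpha>) \<in> D" "(last \<alpha>, b) \<in> D"
      using entourage_sym[OF D \<alpha>'(2)] b(1) by auto
    have carr': "a \<in> carrier X" "b \<in> carrier X"
      using ab entourage_subset[OF D] by auto
    note one = kernel_one[OF K]
    have links: "(act k a, act l b) \<in> E" "(a, act k a) \<in> E" "(b, act k a) \<in> E" "(a, b) \<in> E"
        "(b, act l b) \<in> E"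
      using fine_close[OF fine ab k(1) l(1)] fine_orbit[OF fine carr'(1) one k(1)]
        fine_close[OF fine ab k(1) one] fine_close[OF fine ab one one]
        fine_orbit[OF fine carr'(2) one l(1)] carr' entourage_sym[OF E] by auto
    have links': "(act l b, act k a) \<in> E" "(last \<alpha>, a) \<in> E" "(last \<alpha>, b) \<in> E"
      using entourage_sym[OF E links(1)] \<alpha>'(2) b(1) DE by auto
    have ch: "chain E \<alpha>" "chain E (\<alpha> @ [a])" "chain E (\<alpha> @ [b])"
      using chains_from_mono[OF DE] \<alpha>a(1) \<alpha>b \<alpha>'(1) unfolding \<alpha>(1) by (auto simp: chains_from_def)
    \<comment> \<open>Both chains are rewritten with the initial part \<open>\<alpha>, b, act l b\<close>, which exhibits them as a pair of \<open>star x0 E E\<close>.\<close>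
    have "((\<alpha> @ [a]) @ [act k a], (\<alpha> @ [a]) @ [b, act k a]) \<in> homotopic E"
      using links by (intro homotopic_detour ch) simp_all
    also have "((\<alpha> @ [a]) @ [b, act k a], (\<alpha> @ [b]) @ [act k a]) \<in> homotopic E"
    proof -
      have "(\<alpha> @ [a, b], \<alpha> @ [b]) \<in> homotopic E"
        by (rule homotopic_sym[OF homotopic_detour[OF ch(1) links'(3,2) links(4)]])
      from homotopic_snoc[OF this, of "act k a"] show ?thesis
        using links(3) by simp
    qed
    also have "((\<alpha> @ [b]) @ [act k a], (\<alpha> @ [b]) @ [act l b, act k a]) \<in> homotopic E"
      using links links' by (intro homotopic_detour ch) simp_all
    finally have \<xi>_eq: "\<xi> E = chain_class E ((\<alpha> @ [b, act l b]) @ [act k a])"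
      using k(2) by (simp add: chain_class_eq_iff)
    have \<alpha>bl: "\<alpha> @ [b, act l b] \<in> chains_from x0 E"
      using chains_from_snoc[OF chains_from_mono[OF DE \<alpha>b], of "act l b"] links(5) by simp
    have refl: "(act l b, act l b) \<in> E"
      using fine_orbit[OF fine carr'(2) l(1) l(1)] .
    have "((\<alpha> @ [b, act l b]) @ [act l b], \<alpha> @ [b, act l b]) \<in> homotopic E"
      using homotopic_stutter[of E "\<alpha> @ [b, act l b]"] \<alpha>bl refl by (simp add: chains_from_def)
    then have \<eta>_eq: "\<eta> E = chain_class E ((\<alpha> @ [b, act l b]) @ [act l b])"
      using l(2) by (simp add: chain_class_eq_iff homotopic_sym)
    show ?thesis
      unfolding \<xi>_eq \<eta>_eq using links'(1) refl by (intro starI[OF \<alpha>bl]) (simp_all add: links(1))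
  qed
  then show ?thesis
    using image_entourage[OF D] by blast
qed

subsection \<open>Surjectivity\<close>

text \<open>
  The end of such a lift need not converge as the scale \<open>D\<close> shrinks: at a scale that separates \<open>K\<close> it
  is determined modulo \<open>K\<close> only.
\<close>

definition lift_of :: "(('b \<times> 'b) set \<Rightarrow> 'b list set) \<Rightarrow> ('a \<times> 'a) set \<Rightarrow> 'a list \<Rightarrow> bool" where
  "lift_of \<eta> D \<alpha> \<longleftrightarrow> \<alpha> \<in> chains_from x0 D \<and> \<eta> (map_prod f f ` D) = chain_class (map_prod f f ` D) (map f \<alpha>)"

lemma lift_of_exists:
  assumes "\<eta> \<in> UY" "separates K D"
  shows "\<exists>\<alpha>. lift_of \<eta> D \<alpha>"
proof -
  have D: "D \<in> entourages X" "\<forall>g\<in>carrier G. \<forall>(x, y)\<in>D. (act g x, act g y) \<in> D"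
    using assms(2) unfolding separates_def by blast+
  obtain c where "c \<in> chains_from y0 (map_prod f f ` D)"
      "\<eta> (map_prod f f ` D) = chain_class (map_prod f f ` D) c"
    by (rule univ_rep[OF assms(1) image_entourage[OF D(1)]])
  then show ?thesis
    using chain_lift[OF D] unfolding lift_of_def by blast
qed

lemma lift_of_end:
  assumes "\<eta> \<in> UY" "D \<in> entourages X" "lift_of \<eta> D \<alpha>"
  shows "last \<alpha> \<in> carrier X" "f (last \<alpha>) = univ_cover Y \<eta>"
proof -
  have \<alpha>: "\<alpha> \<in> chains_from x0 D" "\<eta> (map_prod f f ` D) = chain_class (map_prod f f ` D) (map f \<alpha>)"
    using assms(3) by (simp_all add: lift_of_def)
  show "last \<alpha> \<in> carrier X"
    by (rule chains_from_last[OF assms(2) x0 \<alpha>(1)])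
  show "f (last \<alpha>) = univ_cover Y \<eta>"
    using univ_cover_eq[OF Y assms(1) image_entourage[OF assms(2)] \<alpha>(2)] chains_from_nonempty[OF \<alpha>(1)]
    by (simp add: last_map)
qed

lemma lift_of_finer:
  assumes "\<eta> \<in> UY" "K \<in> \<K>" "fine K D E" "D' \<in> entourages X" "D' \<subseteq> D"
    and "lift_of \<eta> D \<alpha>" "lift_of \<eta> D' \<alpha>'"
  shows "same_lift K E \<alpha> \<alpha>'"
proof (rule same_lift_homotopic[OF assms(2,3)])
  note D = fine_entourage(1)[OF assms(3)]
  show "\<alpha> \<in> chains_from x0 D" "\<alpha>' \<in> chains_from x0 D"
    using assms(6,7) chains_from_mono[OF assms(5)] by (auto simp: lift_of_def)
  have "\<eta> (map_prod f f ` D) = chain_class (map_prod f f ` D) (map f \<alpha>')"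
    using assms(7) univ_coarse[OF assms(1) image_entourage[OF assms(4)] image_entourage[OF D]
        image_mono[OF assms(5)]]
    by (simp add: lift_of_def)
  then show "(map f \<alpha>, map f \<alpha>') \<in> homotopic (map_prod f f ` D)"
    using assms(6) by (simp add: lift_of_def chain_class_eq_iff[symmetric])
qed

text \<open>Lifts at two scales are compared through a lift at a common refinement.\<close>

lemma lift_of_ends_equivalent:
  assumes \<eta>: "\<eta> \<in> UY" and K: "K \<in> \<K>" and sep: "separates K D" "separates K D'"
    and lifts: "lift_of \<eta> D \<alpha>" "lift_of \<eta> D' \<alpha>'"
  shows "\<exists>k\<in>K. last \<alpha>' = act k (last \<alpha>)"
proof -
  interpret K: subgroup K G by (rule kernel_subgroup[OF K])
  let ?E = "carrier X \<times> carrier X"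
  note sep'' = separates_Int[OF sep]
  have D: "D \<in> entourages X" "D \<inter> D' \<in> entourages X"
    using separates_entourage[OF sep(1)] separates_entourage[OF sep''] .
  obtain \<alpha>'' where \<alpha>'': "lift_of \<eta> (D \<inter> D') \<alpha>''"
    using lift_of_exists[OF \<eta> sep''] by blast
  obtain k where k: "k \<in> K" "last \<alpha>'' = act k (last \<alpha>)"
    using lift_of_finer[OF \<eta> K separates_fine[OF K sep(1)] D(2) _ lifts(1) \<alpha>''] by (auto simp: same_lift_def)
  have "same_lift K ?E \<alpha>' \<alpha>''"
    using lift_of_finer[OF \<eta> K separates_fine[OF K sep(2)] D(2) _ lifts(2) \<alpha>''] by blast
  then have "same_lift K ?E \<alpha>'' \<alpha>'"
    by (rule same_lift_sym[OF K separates_fine[OF K sep(2)]])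
  then obtain l where l: "l \<in> K" "last \<alpha>' = act l (last \<alpha>'')"
    by (auto simp: same_lift_def)
  have "last \<alpha>' = act (l \<otimes> k) (last \<alpha>)"
    using k l lift_of_end(1)[OF \<eta> D(1) lifts(1)] K.subset act_mult by auto
  with K.m_closed[OF l(1) k(1)] show ?thesis by blast
qed

text \<open>
  Completeness of \<open>G\<close> supplies the point of the fibre that is the end modulo every \<open>K\<close>: the ends
  of the lifts are translates of one point of the fibre, and the translating elements are
  compatible because the action is free.
\<close>

lemma end_point:
  assumes \<eta>: "\<eta> \<in> UY"
  shows "\<exists>x\<in>carrier X. f x = univ_cover Y \<eta> \<and>
    (\<forall>K\<in>\<K>. \<forall>D \<alpha>. separates K D \<longrightarrow> lift_of \<eta> D \<alpha> \<longrightarrow> (\<exists>k\<in>K. x = act k (last \<alpha>)))"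
proof -
  interpret group G by (rule group_G)
  obtain K0 where K0: "K0 \<in> \<K>" using small[OF carrier_entourage[OF X]] by blast
  obtain D0 where D0: "separates K0 D0"
    using separates_below[OF K0 carrier_entourage[OF X]] by blast
  obtain \<alpha>0 where \<alpha>0: "lift_of \<eta> D0 \<alpha>0"
    using lift_of_exists[OF \<eta> D0] by blast
  define p where "p = last \<alpha>0"
  have p: "p \<in> carrier X" "f p = univ_cover Y \<eta>"
    unfolding p_def by (rule lift_of_end[OF \<eta> separates_entourage[OF D0] \<alpha>0])+
  have translate: "\<exists>g\<in>carrier G. last \<alpha> = act g p" if sep: "separates K D" and \<alpha>: "lift_of \<eta> D \<alpha>" for K D \<alpha>
  proof -
    have D: "D \<in> entourages X" using sep by (rule separates_entourage)
    show ?thesis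
      using fibre[OF p(1) lift_of_end(1)[OF \<eta> D \<alpha>]] lift_of_end(2)[OF \<eta> D \<alpha>] p(2) by simp
  qed
  have "\<exists>g. g \<in> carrier G \<and> (\<exists>D \<alpha>. separates K D \<and> lift_of \<eta> D \<alpha> \<and> last \<alpha> = act g p)" if K: "K \<in> \<K>" for K
  proof -
    obtain D where D: "separates K D"
      using separates_below[OF K carrier_entourage[OF X]] by blast
    obtain \<alpha> where \<alpha>: "lift_of \<eta> D \<alpha>"
      using lift_of_exists[OF \<eta> D] by blast
    obtain g where "g \<in> carrier G" "last \<alpha> = act g p"
      using translate[OF D \<alpha>] by blast
    with D \<alpha> show ?thesis by (intro exI[of _ g] conjI exI[of _ D] exI[of _ \<alpha>])
  qed
  then obtain \<gamma> where \<gamma>: "\<And>K. K \<in> \<K> \<Longrightarrow> \<gamma> K \<in> carrier G"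
      "\<And>K. K \<in> \<K> \<Longrightarrow> \<exists>D \<alpha>. separates K D \<and> lift_of \<eta> D \<alpha> \<and> last \<alpha> = act (\<gamma> K) p"
    by metis
  have coset: "\<exists>k\<in>K. last \<alpha> = act (k \<otimes> \<gamma> K) p"
    if K: "K \<in> \<K>" and sep: "separates K D" and \<alpha>: "lift_of \<eta> D \<alpha>" for K D \<alpha>
  proof -
    obtain D' \<alpha>' where *: "separates K D'" "lift_of \<eta> D' \<alpha>'" "last \<alpha>' = act (\<gamma> K) p"
      using \<gamma>(2)[OF K] by blast
    obtain k where "k \<in> K" "last \<alpha> = act k (last \<alpha>')"
      using lift_of_ends_equivalent[OF \<eta> K *(1) sep *(2) \<alpha>] by blast
    then show ?thesis
      using *(3) act_mult[OF kernel_carrier[OF K] \<gamma>(1)[OF K] p(1)] by auto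
  qed
  have "\<exists>h\<in>carrier G. \<forall>K\<in>\<K>. h \<otimes> inv (\<gamma> K) \<in> K"
  proof (rule complete)
    show "\<gamma> \<in> \<K> \<rightarrow> carrier G" using \<gamma>(1) by simp
    fix K L assume K: "K \<in> \<K>" and L: "L \<in> \<K>" and "L \<subseteq> K"
    obtain D \<alpha> where *: "separates L D" "lift_of \<eta> D \<alpha>" "last \<alpha> = act (\<gamma> L) p"
      using \<gamma>(2)[OF L] by blast
    obtain k where k: "k \<in> K" "last \<alpha> = act (k \<otimes> \<gamma> K) p"
      using coset[OF K separates_superset[OF *(1) \<open>L \<subseteq> K\<close>] *(2)] by blast
    have kG: "k \<in> carrier G" by (rule kernel_carrier[OF K k(1)])
    have "\<gamma> L = k \<otimes> \<gamma> K"
      using act_free[OF \<gamma>(1)[OF L] m_closed[OF kG \<gamma>(1)[OF K]] p(1)] *(3) k(2) by simp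
    then show "\<gamma> L \<otimes> inv (\<gamma> K) \<in> K"
      using k(1) kG \<gamma>(1)[OF K] by (simp add: m_assoc)
  qed
  then obtain h where h: "h \<in> carrier G" "\<forall>K\<in>\<K>. h \<otimes> inv (\<gamma> K) \<in> K" by blast
  have "\<exists>k\<in>K. act h p = act k (last \<alpha>)"
    if K: "K \<in> \<K>" and sep: "separates K D" and \<alpha>: "lift_of \<eta> D \<alpha>" for K D \<alpha>
  proof -
    interpret K: subgroup K G by (rule kernel_subgroup[OF K])
    obtain k where k: "k \<in> K" "last \<alpha> = act (k \<otimes> \<gamma> K) p"
      using coset[OF K sep \<alpha>] by blast
    note G = h(1) \<gamma>(1)[OF K] kernel_carrier[OF K k(1)]
    have "h \<otimes> inv (\<gamma> K) \<in> K" using h(2) K by blast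
    from K.m_closed[OF this K.m_inv_closed[OF k(1)]]
    have "(h \<otimes> inv (\<gamma> K)) \<otimes> inv k \<in> K" .
    moreover have "act ((h \<otimes> inv (\<gamma> K)) \<otimes> inv k) (last \<alpha>) = act h p"
    proof -
      have "inv k \<otimes> (k \<otimes> \<gamma> K) = \<gamma> K"
        using G by (simp add: m_assoc[symmetric])
      then have "((h \<otimes> inv (\<gamma> K)) \<otimes> inv k) \<otimes> (k \<otimes> \<gamma> K) = h"
        using G by (simp add: m_assoc)
      then show ?thesis
        unfolding k(2) using G p(1) by (simp add: act_mult[symmetric])
    qed
    ultimately show ?thesis by metis
  qed
  then show ?thesis
    using h(1) p act_closed f_act by (intro bexI[of _ "act h p"]) auto
qed

text \<open>
  At each scale \<open>E\<close>, a fine lift \<open>\<alpha>\<close> of \<open>\<eta>\<close> is corrected by one step to end in the point \<open>x\<close> of the previous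
  lemma.  The class of the result does not depend on \<open>\<alpha>\<close>, because any two lifts are compared with a
  lift at a common refinement and all corrections are \<open>E\<close>-steps.
\<close>

lemma lift_surj:
  assumes \<eta>: "\<eta> \<in> UY"
  shows "\<exists>\<xi>\<in>UX. F \<xi> = \<eta>"
proof -
  obtain x where x: "x \<in> carrier X" "f x = univ_cover Y \<eta>"
      and x_end: "\<And>K D \<alpha>. K \<in> \<K> \<Longrightarrow> separates K D \<Longrightarrow> lift_of \<eta> D \<alpha> \<Longrightarrow> \<exists>k\<in>K. x = act k (last \<alpha>)"
    using end_point[OF \<eta>] by blast
  define R where "R E \<alpha> \<longleftrightarrow> (\<exists>K\<in>\<K>. \<exists>D. fine K D E \<and> lift_of \<eta> D \<alpha>)" for E \<alpha>
  have R_exists: "\<exists>\<alpha>. R E \<alpha>" if "E \<in> entourages X" for E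
    using fine_exists[OF that] lift_of_exists[OF \<eta>] unfolding R_def fine_def by blast
  have R_mono: "R E' \<alpha>" if "R E \<alpha>" "E \<subseteq> E'" "E' \<in> entourages X" for E E' \<alpha>
    using that fine_superset unfolding R_def by blast
  have R_link: "\<alpha> \<in> chains_from x0 E \<and> (last \<alpha>, x) \<in> E" if R: "R E \<alpha>" for E \<alpha>
  proof -
    obtain K D where *: "K \<in> \<K>" "fine K D E" "lift_of \<eta> D \<alpha>"
      using R unfolding R_def by blast
    have \<alpha>: "\<alpha> \<in> chains_from x0 D" using *(3) by (simp add: lift_of_def)
    obtain k where "k \<in> K" "x = act k (last \<alpha>)"
      using x_end[OF *(1) _ *(3)] *(2) by (auto simp: fine_def)
    then show ?thesis
      using chains_from_mono[OF fine_subset[OF *(1,2)] \<alpha>]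
        orbit_E[OF *(1,2) chains_from_last[OF fine_entourage(1)[OF *(2)] x0 \<alpha>]] by auto
  qed
  have R_unique: "(\<alpha> @ [x], \<beta> @ [x]) \<in> homotopic E" if R: "R E \<alpha>" "R E \<beta>" for E \<alpha> \<beta>
  proof -
    have to_common: "(\<alpha> @ [x], \<gamma> @ [x]) \<in> homotopic E"
      if K: "K \<in> \<K>" and fine: "fine K D E" and \<alpha>: "lift_of \<eta> D \<alpha>"
        and D': "separates L D'" "D' \<subseteq> D" and \<gamma>: "lift_of \<eta> D' \<gamma>" "(last \<gamma>, x) \<in> E" for K D L D' \<alpha> \<gamma>
    proof -
      have same: "same_lift K E \<alpha> \<gamma>"
        using lift_of_finer[OF \<eta> K fine separates_entourage[OF D'(1)] D'(2) \<alpha> \<gamma>(1)] .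
      then obtain l where l: "l \<in> K" "last \<gamma> = act l (last \<alpha>)"
        by (auto simp: same_lift_def)
      have RE: "R E \<alpha>" using K fine \<alpha> unfolding R_def by blast
      have ch: "chain E \<alpha>" "last \<alpha> \<in> carrier X" and hom: "(\<alpha> @ [last \<gamma>], \<gamma>) \<in> homotopic E"
        using same by (auto simp: same_lift_def)
      have "(last \<alpha>, last \<gamma>) \<in> E"
        unfolding l(2) by (rule orbit_E[OF K fine ch(2) l(1)])
      then have "(\<alpha> @ [x], (\<alpha> @ [last \<gamma>]) @ [x]) \<in> homotopic E"
        using homotopic_detour[OF ch(1), of x "last \<gamma>"] R_link[OF RE] \<gamma>(2) by simp
      also have "((\<alpha> @ [last \<gamma>]) @ [x], \<gamma> @ [x]) \<in> homotopic E"
        using \<gamma>(2) by (intro homotopic_snoc[OF hom]) simp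
      finally show ?thesis .
    qed
    obtain K D where \<alpha>: "K \<in> \<K>" "fine K D E" "lift_of \<eta> D \<alpha>"
      using R(1) unfolding R_def by blast
    obtain L D' where \<beta>: "L \<in> \<K>" "fine L D' E" "lift_of \<eta> D' \<beta>"
      using R(2) unfolding R_def by blast
    have sep: "separates K D" "separates L D'" using \<alpha>(2) \<beta>(2) by (simp_all add: fine_def)
    note sep' = separates_Int[OF sep]
    obtain \<gamma> where \<gamma>: "lift_of \<eta> (D \<inter> D') \<gamma>"
      using lift_of_exists[OF \<eta> sep'] by blast
    have "R E \<gamma>"
      unfolding R_def using \<alpha>(1) fine_Int[OF \<alpha>(2) sep(2)] \<gamma> by blast
    then have "(last \<gamma>, x) \<in> E" using R_link by blast
    then have "(\<alpha> @ [x], \<gamma> @ [x]) \<in> homotopic E" "(\<beta> @ [x], \<gamma> @ [x]) \<in> homotopic E"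
      using to_common[OF \<alpha> sep' _ \<gamma>] to_common[OF \<beta> sep' _ \<gamma>] by simp_all
    then show ?thesis
      by (rule homotopic_trans[OF _ homotopic_sym])
  qed
  define \<xi> where "\<xi> = (\<lambda>E\<in>entourages X. chain_class E ((SOME \<alpha>. R E \<alpha>) @ [x]))"
  have \<xi>_eq: "\<xi> E = chain_class E (\<alpha> @ [x])" if "E \<in> entourages X" "R E \<alpha>" for E \<alpha>
  proof -
    have "R E (SOME \<alpha>. R E \<alpha>)" using that(2) by (rule someI)
    then show ?thesis
      using R_unique[OF _ that(2)] that(1) by (simp add: \<xi>_def chain_class_eq_iff)
  qed
  have \<xi>: "\<xi> \<in> UX"
  proof (rule univI)
    show "\<xi> \<in> extensional (entourages X)" by (simp add: \<xi>_def)
    fix D E assume *: "D \<in> entourages X" "E \<in> entourages X" "D \<subseteq> E"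
    obtain \<alpha> where \<alpha>: "R D \<alpha>" using R_exists[OF *(1)] by blast
    show "\<exists>\<alpha>\<in>chains_from x0 D. \<xi> D = chain_class D \<alpha> \<and> \<xi> E = chain_class E \<alpha>"
    proof (intro bexI conjI)
      show "\<alpha> @ [x] \<in> chains_from x0 D"
        using R_link[OF \<alpha>] by (simp add: chains_from_snoc)
    qed (rule \<xi>_eq[OF *(1) \<alpha>], rule \<xi>_eq[OF *(2) R_mono[OF \<alpha> *(3,2)]])
  qed
  have "F \<xi> = \<eta>"
  proof (rule univ_ext[OF lift_in[OF \<xi>] \<eta>])
    fix C assume C: "C \<in> entourages Y"
    define E where "E = pullback X f C"
    have E: "E \<in> entourages X" and fE: "\<forall>(x, y)\<in>E. (f x, f y) \<in> C"
      unfolding E_def using pullback_entourage[OF X ucont_f C] by (auto simp: pullback_def)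
    obtain \<alpha> where R: "R E \<alpha>" using R_exists[OF E] by blast
    then obtain K D where \<alpha>: "K \<in> \<K>" "fine K D E" "lift_of \<eta> D \<alpha>"
      unfolding R_def by blast
    note D = fine_entourage(1)[OF \<alpha>(2)]
    have ne: "\<alpha> \<noteq> []" by (rule chains_from_nonempty[OF conjunct1[OF R_link[OF R]]])
    have fx: "f x = last (map f \<alpha>)"
      using x(2) lift_of_end(2)[OF \<eta> D \<alpha>(3)] ne by (simp add: last_map)
    have chain: "chain C (map f \<alpha>)"
      using chain_map[OF fE, of \<alpha>] R_link[OF R] by (simp add: chains_from_def)
    have "(last (map f \<alpha>), last (map f \<alpha>)) \<in> C"
      unfolding fx[symmetric] using imageI[OF x(1), of f] onto by (intro entourage_refl[OF Y C]) simp
    then have "(map f \<alpha> @ [last (map f \<alpha>)], map f \<alpha>) \<in> homotopic C"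
      by (rule homotopic_stutter[OF chain])
    moreover have "F \<xi> C = chain_class C (map f (\<alpha> @ [x]))"
      by (rule lift_map_eq[OF X ucont_f \<xi> E C fE \<xi>_eq[OF E R]])
    moreover have "map_prod f f ` D \<subseteq> C"
      using fine_subset[OF \<alpha>(1,2)] fE by auto
    then have "\<eta> C = chain_class C (map f \<alpha>)"
      using univ_coarse[OF \<eta> image_entourage[OF D] C] \<alpha>(3) by (simp add: lift_of_def)
    ultimately show "F \<xi> C = \<eta> C"
      using fx by (simp add: chain_class_eq_iff)
  qed
  with \<xi> show ?thesis by blast
qed

lemma lift_uhomeo: "uhomeo (univ_space X x0) (univ_space Y y0) F"
  unfolding uhomeo_def
proof (intro conjI)
  have img: "F ` UX = UY"
    using lift_in lift_surj by blast
  show "bij_betw F UX UY"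
    using lift_inj img by (simp add: bij_betw_def)
  show "ucont (univ_space X x0) (univ_space Y y0) F"
    using is_lift_lift_map[OF X Y x0 ucont_f f_base] by (simp add: is_lift_def)
  show "ucont (univ_space Y y0) (univ_space X x0) (inv_into UX F)"
    unfolding ucont_univ_iff[OF Y X]
  proof (intro conjI ballI)
    show "inv_into UX F \<in> UY \<rightarrow> UX"
      using inv_into_into[of _ F UX] img by auto
    fix E assume "E \<in> entourages X"
    then obtain C where C: "C \<in> entourages Y"
        "\<forall>\<xi>\<in>UX. \<forall>\<eta>\<in>UX. (F \<xi> C, F \<eta> C) \<in> star y0 C C \<longrightarrow> (\<xi> E, \<eta> E) \<in> star x0 E E"
      using lift_inverse_ucont by blast
    show "\<exists>C\<in>entourages Y. \<forall>\<xi>\<in>UY. \<forall>\<eta>\<in>UY. (\<xi> C, \<eta> C) \<in> star y0 C C \<longrightarrow>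
        (inv_into UX F \<xi> E, inv_into UX F \<eta> E) \<in> star x0 E E"
    proof (intro bexI[OF _ C(1)] ballI impI)
      fix \<xi> \<eta> assume "\<xi> \<in> UY" "\<eta> \<in> UY" "(\<xi> C, \<eta> C) \<in> star y0 C C"
      then show "(inv_into UX F \<xi> E, inv_into UX F \<eta> E) \<in> star x0 E E"
        using C(2) inv_into_into[of _ F UX] f_inv_into_f[of _ F UX] img by simp
    qed
  qed
qed

end

section \<open>Kernels of a prodiscrete action\<close>

lemma ucont_lim_projection:
  assumes "directed I leq" "\<And>i j. i \<in> I \<Longrightarrow> j \<in> I \<Longrightarrow> leq i j \<Longrightarrow> ucont (Xs j) (Xs i) (b i j)" "i \<in> I"
  shows "ucont (lim_space I leq Xs b) (Xs i) (\<lambda>z. z i)"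
  unfolding ucont_def filterlim_iff
proof (intro conjI allI impI)
  show "(\<lambda>z. z i) \<in> carrier (lim_space I leq Xs b) \<rightarrow> carrier (Xs i)"
    using assms(3) by (auto simp: lim_space_def lim_set_def Let_def)
  fix P assume "eventually P (unif (Xs i))"
  then show "eventually (\<lambda>p. P (map_prod (\<lambda>z. z i) (\<lambda>z. z i) p)) (unif (lim_space I leq Xs b))"
    by (intro iffD2[OF eventually_lim_space[where leq = leq and b = b]] assms(1,2)
        bexI[OF _ assms(3)] exI[of _ P]) simp_all
qed

text \<open>
  The kernels of the projections to the discrete factors will do.  Their orbits are small because an
  entourage of the limit is controlled by one factor, on which the kernel acts trivially; discreteness
  of the factors puts the elements with small displacements into the kernels; and limits of
  compatible families exist because \<open>G \<longrightarrow> lim G\<^sub>i\<close> is onto.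
\<close>

lemma prodiscrete_kernels:
  fixes act :: "'g \<Rightarrow> 'a \<Rightarrow> 'a"
  assumes X: "uspace X" and "prodiscrete_action TYPE('i \<times> 'p \<times> 'h) G X act"
  obtains \<K> where "\<And>K. K \<in> \<K> \<Longrightarrow> subgroup K G"
    and "\<And>K. K \<in> \<K> \<Longrightarrow> \<exists>E\<in>entourages X. \<forall>g\<in>carrier G. \<forall>x\<in>carrier X. (x, act g x) \<in> E \<longrightarrow> g \<in> K"
    and "\<And>E. E \<in> entourages X \<Longrightarrow> \<exists>K\<in>\<K>. \<forall>g\<in>K. \<forall>x\<in>carrier X. (x, act g x) \<in> E"
    and "\<And>g. g \<in> carrier G \<Longrightarrow> (\<And>K. K \<in> \<K> \<Longrightarrow> g \<in> K) \<Longrightarrow> g = \<one>\<^bsub>G\<^esub>"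
    and "\<And>\<gamma>. \<gamma> \<in> \<K> \<rightarrow> carrier G \<Longrightarrow>
      (\<And>K L. K \<in> \<K> \<Longrightarrow> L \<in> \<K> \<Longrightarrow> L \<subseteq> K \<Longrightarrow> \<gamma> L \<otimes>\<^bsub>G\<^esub> inv\<^bsub>G\<^esub> (\<gamma> K) \<in> K) \<Longrightarrow>
      \<exists>h\<in>carrier G. \<forall>K\<in>\<K>. h \<otimes>\<^bsub>G\<^esub> inv\<^bsub>G\<^esub> (\<gamma> K) \<in> K"
proof -
  have uact: "uniform_action G X act"
    using assms(2) unfolding prodiscrete_action_def by (rule conjunct1)
  obtain I :: "'i set" and leq and Xs :: "'i \<Rightarrow> 'p uspace" and b and Gs :: "'i \<Rightarrow> 'h monoid"
      and h acts \<Phi> \<Theta> where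
      dir: "directed I leq"
    and fac: "\<forall>i\<in>I. uspace (Xs i) \<and> group (Gs i) \<and> discrete_action (Gs i) (Xs i) (acts i)"
    and bond: "\<forall>i\<in>I. \<forall>j\<in>I. leq i j \<longrightarrow>
           ucont (Xs j) (Xs i) (b i j) \<and> h i j \<in> hom (Gs j) (Gs i) \<and>
           (\<forall>g\<in>carrier (Gs j). \<forall>x\<in>carrier (Xs j).
              b i j (acts j g x) = acts i (h i j g) (b i j x))"
    and \<Phi>: "uhomeo X (lim_space I leq Xs b) \<Phi>"
    and \<Theta>: "\<Theta> \<in> iso G (lim_group I leq Gs h)"
    and equi: "\<forall>g\<in>carrier G. \<forall>x\<in>carrier X. \<forall>i\<in>I. \<Phi> (act g x) i = acts i (\<Theta> g i) (\<Phi> x i)"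
    using assms(2) unfolding prodiscrete_action_def by (elim conjE exE) blast
  let ?L = "lim_set I leq (\<lambda>i. carrier (Xs i)) b"
  have fac': "uspace (Xs i)" "group (Gs i)" "discrete_action (Gs i) (Xs i) (acts i)" if "i \<in> I" for i
    using fac that by auto
  have bond': "ucont (Xs j) (Xs i) (b i j)" "h i j \<in> hom (Gs j) (Gs i)"
    if "i \<in> I" "j \<in> I" "leq i j" for i j
    using bond that by auto
  have act: "group_action G (carrier X) act"
    using uact by (simp add: uniform_action_def)
  interpret group_action G "carrier X" act by (rule act)
  interpret group G using group_hom by (rule group_hom.axioms)
  have \<Theta>G: "carrier (lim_group I leq Gs h) = lim_set I leq (\<lambda>i. carrier (Gs i)) h"
    by (simp add: lim_group_def)
  have \<Theta>_in: "\<Theta> g \<in> lim_set I leq (\<lambda>i. carrier (Gs i)) h" if "g \<in> carrier G" for g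
    using \<Theta> that unfolding iso_def hom_def \<Theta>G by auto
  have \<Theta>_mult: "\<Theta> (g \<otimes>\<^bsub>G\<^esub> g') i = \<Theta> g i \<otimes>\<^bsub>Gs i\<^esub> \<Theta> g' i"
    if "g \<in> carrier G" "g' \<in> carrier G" "i \<in> I" for g g' i
    using \<Theta> that by (simp add: iso_def hom_def lim_group_def product_group_def)
  have \<Theta>_bij: "bij_betw \<Theta> (carrier G) (lim_set I leq (\<lambda>i. carrier (Gs i)) h)"
    using \<Theta> by (simp add: iso_def \<Theta>G)
  have \<Theta>_bond: "h i j (\<Theta> g j) = \<Theta> g i" if "i \<in> I" "j \<in> I" "leq i j" "g \<in> carrier G" for i j g
    using \<Theta>_in[OF that(4)] that(1-3) by (simp add: lim_set_def)
  have proj: "group_hom G (Gs i) (\<lambda>g. \<Theta> g i)" if i: "i \<in> I" for i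
  proof -
    have "(\<lambda>g. \<Theta> g i) \<in> hom G (Gs i)"
      using \<Theta>_in \<Theta>_mult i by (auto simp: hom_def lim_set_def)
    then show ?thesis
      using fac'(2)[OF i] group_axioms by (simp add: group_hom_def group_hom_axioms_def)
  qed
  define ker where "ker i = kernel G (Gs i) (\<lambda>g. \<Theta> g i)" for i
  have ker: "g \<in> ker i \<longleftrightarrow> g \<in> carrier G \<and> \<Theta> g i = \<one>\<^bsub>Gs i\<^esub>" for g i
    by (simp add: ker_def kernel_def)
  have ker_coset: "g \<otimes>\<^bsub>G\<^esub> inv\<^bsub>G\<^esub> g' \<in> ker i \<longleftrightarrow> \<Theta> g i = \<Theta> g' i"
    if "i \<in> I" "g \<in> carrier G" "g' \<in> carrier G" for i g g'
  proof -
    interpret p: group_hom G "Gs i" "\<lambda>g. \<Theta> g i" by (rule proj[OF that(1)])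
    have "\<Theta> (g \<otimes>\<^bsub>G\<^esub> inv\<^bsub>G\<^esub> g') i = \<Theta> g i \<otimes>\<^bsub>Gs i\<^esub> inv\<^bsub>Gs i\<^esub> (\<Theta> g' i)"
      using that by simp
    then show ?thesis
      unfolding ker using that p.hom_closed p.H.inv_solve_right'[of "\<one>\<^bsub>Gs i\<^esub>" "\<Theta> g i" "\<Theta> g' i"]
      by simp
  qed
  have ker_mono: "ker j \<subseteq> ker i" if ij: "i \<in> I" "j \<in> I" "leq i j" for i j
  proof
    fix g assume g: "g \<in> ker j"
    then have "\<Theta> g i = h i j \<one>\<^bsub>Gs j\<^esub>"
      using \<Theta>_bond[OF ij, of g] unfolding ker by (elim conjE) simp
    also have "\<dots> = \<one>\<^bsub>Gs i\<^esub>"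
      using hom_one[OF bond'(2)[OF ij] fac'(2)[OF ij(2)] fac'(2)[OF ij(1)]] .
    finally show "g \<in> ker i" using g by (simp add: ker)
  qed
  have \<Phi>_in: "\<Phi> x \<in> ?L" if "x \<in> carrier X" for x
    using \<Phi> that by (auto simp: uhomeo_def bij_betw_def lim_space_def Let_def)
  have \<Phi>_fac: "\<Phi> x i \<in> carrier (Xs i)" if "x \<in> carrier X" "i \<in> I" for x i
    using \<Phi>_in[OF that(1)] that(2) by (auto simp: lim_set_def)
  have \<Phi>_ucont: "ucont X (lim_space I leq Xs b) \<Phi>"
      "ucont (lim_space I leq Xs b) X (inv_into (carrier X) \<Phi>)"
    using \<Phi> by (simp_all add: uhomeo_def)
  have inv_\<Phi>: "inv_into (carrier X) \<Phi> (\<Phi> x) = x" if "x \<in> carrier X" for x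
    using \<Phi> that by (simp add: uhomeo_def bij_betw_def inv_into_f_f)
  show thesis
  proof (rule that[of "ker ` I"])
    fix K assume "K \<in> ker ` I"
    then obtain i where i: "i \<in> I" "K = ker i" by blast
    show "subgroup K G"
      unfolding i(2) ker_def by (rule group_hom.subgroup_kernel[OF proj[OF i(1)]])
    obtain A where A: "A \<in> entourages (Xs i)"
        "\<forall>g\<in>carrier (Gs i). (\<exists>x\<in>carrier (Xs i). (acts i g x, x) \<in> A) \<longrightarrow> g = \<one>\<^bsub>Gs i\<^esub>"
      using fac'(3)[OF i(1)] unfolding discrete_action_def by blast
    have "ucont X (Xs i) ((\<lambda>z. z i) \<circ> \<Phi>)"
      by (rule ucont_compose[OF \<Phi>_ucont(1) ucont_lim_projection[where Xs = Xs, OF dir bond'(1) i(1)]])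
    from pullback_entourage[OF X this A(1)]
    show "\<exists>E\<in>entourages X. \<forall>g\<in>carrier G. \<forall>x\<in>carrier X. (x, act g x) \<in> E \<longrightarrow> g \<in> K"
    proof (rule rev_bexI, intro ballI impI)
      fix g x assume g: "g \<in> carrier G" and x: "x \<in> carrier X"
        and "(x, act g x) \<in> pullback X ((\<lambda>z. z i) \<circ> \<Phi>) A"
      then have "(\<Phi> x i, acts i (\<Theta> g i) (\<Phi> x i)) \<in> A"
        using equi i(1) by (simp add: pullback_def)
      then have "(acts i (\<Theta> g i) (\<Phi> x i), \<Phi> x i) \<in> A"
        by (rule entourage_sym[OF A(1)])
      moreover have "\<Theta> g i \<in> carrier (Gs i)"
        using \<Theta>_in[OF g] i(1) by (auto simp: lim_set_def)
      ultimately have "\<Theta> g i = \<one>\<^bsub>Gs i\<^esub>"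
        using A(2) \<Phi>_fac[OF x i(1)] by blast
      then show "g \<in> K" using g by (simp add: i(2) ker)
    qed
  next
    fix E assume "E \<in> entourages X"
    then have "eventually (\<lambda>p. p \<in> E) (unif X)"
      by (simp add: entourages_def)
    then have "eventually (\<lambda>p. map_prod (inv_into (carrier X) \<Phi>) (inv_into (carrier X) \<Phi>) p \<in> E)
        (unif (lim_space I leq Xs b))"
      by (rule ucont_eventually[OF \<Phi>_ucont(2)])
    then obtain i Q where i: "i \<in> I" "eventually Q (unif (Xs i))"
      and Q: "\<forall>z\<in>?L. \<forall>w\<in>?L. Q (z i, w i) \<longrightarrow>
        map_prod (inv_into (carrier X) \<Phi>) (inv_into (carrier X) \<Phi>) (z, w) \<in> E"
      using iffD1[OF eventually_lim_space[where X = Xs, OF dir bond'(1)]] by blast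
    have "(x, act g x) \<in> E" if g: "g \<in> ker i" and x: "x \<in> carrier X" for g x
    proof -
      have gG: "g \<in> carrier G" and one: "\<Theta> g i = \<one>\<^bsub>Gs i\<^esub>"
        using g by (simp_all add: ker)
      have gx: "act g x \<in> carrier X"
        using element_image[OF gG x refl] .
      have "group_action (Gs i) (carrier (Xs i)) (acts i)"
        using fac'(3)[OF i(1)] by (simp add: discrete_action_def uniform_action_def)
      then have "acts i \<one>\<^bsub>Gs i\<^esub> (\<Phi> x i) = \<Phi> x i"
        using group_action.id_eq_one \<Phi>_fac[OF x i(1)] by (metis restrict_apply')
      then have "\<Phi> (act g x) i = \<Phi> x i"
        using equi gG x i(1) one by simp
      moreover have "Q (\<Phi> x i, \<Phi> x i)"
        using fac'(1)[OF i(1)] i(2) \<Phi>_fac[OF x i(1)] unfolding uspace_def by blast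
      ultimately have "map_prod (inv_into (carrier X) \<Phi>) (inv_into (carrier X) \<Phi>) (\<Phi> x, \<Phi> (act g x)) \<in> E"
        using Q \<Phi>_in[OF x] \<Phi>_in[OF gx] by simp
      then show ?thesis
        using inv_\<Phi>[OF x] inv_\<Phi>[OF gx] by simp
    qed
    then show "\<exists>K\<in>ker ` I. \<forall>g\<in>K. \<forall>x\<in>carrier X. (x, act g x) \<in> E"
      using i(1) by blast
  next
    fix g assume g: "g \<in> carrier G" and all: "\<And>K. K \<in> ker ` I \<Longrightarrow> g \<in> K"
    have "\<Theta> g i = \<Theta> \<one>\<^bsub>G\<^esub> i" if i: "i \<in> I" for i
      using all[OF imageI[OF i]] group_hom.hom_one[OF proj[OF i]] by (simp add: ker)
    moreover have "\<Theta> g \<in> (\<Pi>\<^sub>E i\<in>I. carrier (Gs i))" "\<Theta> \<one>\<^bsub>G\<^esub> \<in> (\<Pi>\<^sub>E i\<in>I. carrier (Gs i))"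
      using \<Theta>_in[OF g] \<Theta>_in[OF one_closed] by (simp_all add: lim_set_def)
    ultimately have "\<Theta> g = \<Theta> \<one>\<^bsub>G\<^esub>"
      by (intro PiE_ext)
    then show "g = \<one>\<^bsub>G\<^esub>"
      using \<Theta>_bij g one_closed by (auto simp: bij_betw_def dest: inj_onD)
  next
    fix \<gamma> assume \<gamma>: "\<gamma> \<in> ker ` I \<rightarrow> carrier G"
      and compat: "\<And>K L. K \<in> ker ` I \<Longrightarrow> L \<in> ker ` I \<Longrightarrow> L \<subseteq> K \<Longrightarrow> \<gamma> L \<otimes>\<^bsub>G\<^esub> inv\<^bsub>G\<^esub> (\<gamma> K) \<in> K"
    have \<gamma>': "\<gamma> (ker i) \<in> carrier G" if "i \<in> I" for i
      using \<gamma> that by auto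
    \<comment> \<open>The value of \<open>\<gamma>\<close> at the kernel of index \<open>i\<close> matters only modulo that kernel, that is, by its component at \<open>i\<close>.\<close>
    define t where "t = (\<lambda>i\<in>I. \<Theta> (\<gamma> (ker i)) i)"
    have "t \<in> lim_set I leq (\<lambda>i. carrier (Gs i)) h"
      unfolding lim_set_def mem_Collect_eq
    proof (intro conjI ballI impI)
      show "t \<in> (\<Pi>\<^sub>E i\<in>I. carrier (Gs i))"
        using \<Theta>_in[OF \<gamma>'] by (auto simp: t_def lim_set_def)
      fix i j assume ij: "i \<in> I" "j \<in> I" "leq i j"
      have "\<gamma> (ker j) \<otimes>\<^bsub>G\<^esub> inv\<^bsub>G\<^esub> (\<gamma> (ker i)) \<in> ker i"
        using compat[OF imageI[OF ij(1)] imageI[OF ij(2)] ker_mono[OF ij]] .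
      then show "h i j (t j) = t i"
        using ker_coset[OF ij(1) \<gamma>'[OF ij(2)] \<gamma>'[OF ij(1)]] \<Theta>_bond[OF ij \<gamma>'[OF ij(2)]] ij
        by (simp add: t_def)
    qed
    then obtain k where k: "k \<in> carrier G" "\<Theta> k = t"
      using \<Theta>_bij unfolding bij_betw_def by (metis imageE)
    have "k \<otimes>\<^bsub>G\<^esub> inv\<^bsub>G\<^esub> (\<gamma> (ker i)) \<in> ker i" if i: "i \<in> I" for i
      using ker_coset[OF i k(1) \<gamma>'[OF i]] k(2) i by (simp add: t_def)
    with k(1) show "\<exists>h\<in>carrier G. \<forall>K\<in>ker ` I. h \<otimes>\<^bsub>G\<^esub> inv\<^bsub>G\<^esub> (\<gamma> K) \<in> K"
      by blast
  qed
qed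

text \<open>
  Besides the kernels this uses that the quotient uniformity consists of the images of entourages, so
  that \<open>f\<close> maps entourages to entourages.
\<close>

lemma cover_small_kernel_quotient:
  assumes X: "uspace X" "x0 \<in> carrier X" and Y: "uspace Y" and f: "ucont X Y f" "f x0 = y0"
    and cover: "is_cover TYPE('g \<times> 'i \<times> 'p \<times> 'h) X Y f"
  shows "\<exists>(G :: 'g monoid) act \<K>. small_kernel_quotient X x0 Y y0 f G act \<K>"
proof -
  obtain G :: "'g monoid" and act k where
      iso: "isomorphic_action G X act"
    and pro: "prodiscrete_action TYPE('i \<times> 'p \<times> 'h) G X act"
    and k: "uhomeo (quotient_space G X act) Y k"
    and fk: "\<forall>x\<in>carrier X. f x = k (orbit G act x)"
    using cover unfolding is_cover_def by blast
  have act: "group_action G (carrier X) act"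
    using iso by (simp add: isomorphic_action_def uniform_action_def)
  interpret group_action G "carrier X" act by (rule act)
  interpret group G using group_hom by (rule group_hom.axioms)
  have k_bij: "bij_betw k (orbits G (carrier X) act) (carrier Y)"
    and k_inv: "ucont Y (quotient_space G X act) (inv_into (orbits G (carrier X) act) k)"
    using k by (simp_all add: uhomeo_def quotient_space_def)
  have orbit_in: "orbit G act x \<in> orbits G (carrier X) act" if "x \<in> carrier X" for x
    using that by (auto simp: orbits_def)
  have orbit_eq: "orbit G act x = orbit G act x' \<longleftrightarrow> (\<exists>g\<in>carrier G. x' = act g x)"
    if x: "x \<in> carrier X" "x' \<in> carrier X" for x x'
  proof
    have "x' \<in> orbit G act x'" using x(2) by (rule orbit_refl)
    then show "\<exists>g\<in>carrier G. x' = act g x" if "orbit G act x = orbit G act x'"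
      using that by (auto simp: orbit_def)
  next
    assume "\<exists>g\<in>carrier G. x' = act g x"
    then obtain g where g: "g \<in> carrier G" "x' = act g x" by blast
    show "orbit G act x = orbit G act x'"
    proof
      show "orbit G act x \<subseteq> orbit G act x'"
      proof
        fix z assume "z \<in> orbit G act x"
        then obtain a where a: "a \<in> carrier G" "z = act a x" by (auto simp: orbit_def)
        have "act (inv\<^bsub>G\<^esub> g) x' = x" using orbit_sym_aux[OF g(1) x(1)] g(2) by simp
        then have "z = act (a \<otimes>\<^bsub>G\<^esub> inv\<^bsub>G\<^esub> g) x'"
          using composition_rule[OF x(2) a(1), of "inv\<^bsub>G\<^esub> g"] g(1) a(2) by simp
        then show "z \<in> orbit G act x'" using a(1) g(1) by (auto simp: orbit_def)
      qed
      show "orbit G act x' \<subseteq> orbit G act x"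
      proof
        fix z assume "z \<in> orbit G act x'"
        then obtain a where a: "a \<in> carrier G" "z = act a x'" by (auto simp: orbit_def)
        then have "z = act (a \<otimes>\<^bsub>G\<^esub> g) x"
          using composition_rule[OF x(1) a(1) g(1)] g(2) by simp
        then show "z \<in> orbit G act x" using a(1) g(1) by (auto simp: orbit_def)
      qed
    qed
  qed
  obtain \<K> where \<K>: "\<And>K. K \<in> \<K> \<Longrightarrow> subgroup K G"
    "\<And>K. K \<in> \<K> \<Longrightarrow> \<exists>E\<in>entourages X. \<forall>g\<in>carrier G. \<forall>x\<in>carrier X. (x, act g x) \<in> E \<longrightarrow> g \<in> K"
    "\<And>E. E \<in> entourages X \<Longrightarrow> \<exists>K\<in>\<K>. \<forall>g\<in>K. \<forall>x\<in>carrier X. (x, act g x) \<in> E"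
    "\<And>g. g \<in> carrier G \<Longrightarrow> (\<And>K. K \<in> \<K> \<Longrightarrow> g \<in> K) \<Longrightarrow> g = \<one>\<^bsub>G\<^esub>"
    "\<And>\<gamma>. \<gamma> \<in> \<K> \<rightarrow> carrier G \<Longrightarrow>
      (\<And>K L. K \<in> \<K> \<Longrightarrow> L \<in> \<K> \<Longrightarrow> L \<subseteq> K \<Longrightarrow> \<gamma> L \<otimes>\<^bsub>G\<^esub> inv\<^bsub>G\<^esub> (\<gamma> K) \<in> K) \<Longrightarrow>
      \<exists>h\<in>carrier G. \<forall>K\<in>\<K>. h \<otimes>\<^bsub>G\<^esub> inv\<^bsub>G\<^esub> (\<gamma> K) \<in> K"
    using prodiscrete_kernels[OF X(1) pro] by blast
  have "small_kernel_quotient X x0 Y y0 f G act \<K>"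
  proof (rule small_kernel_quotient.intro)
    show "f ` carrier X = carrier Y"
    proof -
      have "f ` carrier X = k ` orbits G (carrier X) act"
        using fk by (auto simp: orbits_def image_iff)
      then show ?thesis using k_bij by (simp add: bij_betw_def)
    qed
    show "f x = f x' \<longleftrightarrow> (\<exists>g\<in>carrier G. x' = act g x)" if x: "x \<in> carrier X" "x' \<in> carrier X" for x x'
    proof -
      have "f x = f x' \<longleftrightarrow> k (orbit G act x) = k (orbit G act x')"
        using fk x by simp
      also have "\<dots> \<longleftrightarrow> orbit G act x = orbit G act x'"
        by (rule inj_on_eq_iff[OF bij_betw_imp_inj_on[OF k_bij] orbit_in[OF x(1)] orbit_in[OF x(2)]])
      also note orbit_eq[OF x]
      finally show ?thesis .
    qed
    show "map_prod f f ` D \<in> entourages Y" if D: "D \<in> entourages X" for D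
    proof -
      let ?q = "orbit G act" and ?r = "inv_into (orbits G (carrier X) act) k"
      have "eventually (\<lambda>p. p \<in> D) (unif X)"
        using D by (simp add: entourages_def)
      then have "eventually (\<lambda>p. map_prod ?q ?q p \<in> map_prod ?q ?q ` D) (unif X)"
        by (rule eventually_mono) (rule imageI)
      then have "eventually (\<lambda>p. p \<in> map_prod ?q ?q ` D) (unif (quotient_space G X act))"
        by (simp add: quotient_space_def eventually_filtermap)
      from ucont_eventually[OF k_inv this] eventually_carrier[OF Y]
      have "eventually (\<lambda>p. p \<in> map_prod f f ` D) (unif Y)"
      proof eventually_elim
        case (elim p)
        obtain y z where p: "p = (y, z)" by (rule prod.exhaust)
        obtain u v where uv: "(u, v) \<in> D" "?r y = ?q u" "?r z = ?q v"
          using elim(1) p by auto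
        have "u \<in> carrier X" "v \<in> carrier X"
          using entourage_subset[OF D] uv(1) by auto
        moreover have "k (?r y) = y" "k (?r z) = z"
          using elim(2) p k_bij by (auto simp: bij_betw_def f_inv_into_f)
        ultimately have "f u = y" "f v = z"
          using fk uv by simp_all
        then show ?case using uv(1) p by force
      qed
      moreover have "map_prod f f ` D \<subseteq> carrier Y \<times> carrier Y"
        using entourage_subset[OF D] f(1) by (auto simp: ucont_def Pi_iff)
      moreover have "sym (map_prod f f ` D)"
        using entourage_sym[OF D] by (force intro!: symI)
      ultimately show ?thesis by (simp add: entourages_def)
    qed
    show "\<exists>D\<in>entourages X. D \<subseteq> E \<and> (\<forall>g\<in>carrier G. \<forall>(x, y)\<in>D. (act g x, act g y) \<in> D)"
      if E: "E \<in> entourages X" for E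
    proof -
      obtain B where B: "is_base X B" "\<forall>E\<in>B. \<forall>g\<in>carrier G. map_prod (act g) (act g) ` E = E"
        using iso unfolding isomorphic_action_def by blast
      obtain D where D: "D \<in> B" "D \<subseteq> E"
        using B(1) E unfolding is_base_def by blast
      have "(act g x, act g y) \<in> D" if g: "g \<in> carrier G" and xy: "(x, y) \<in> D" for g x y
      proof -
        have "map_prod (act g) (act g) (x, y) \<in> map_prod (act g) (act g) ` D"
          using xy by (rule imageI)
        then show ?thesis using B(2) D(1) g by simp
      qed
      moreover have "D \<in> entourages X" using B(1) D(1) unfolding is_base_def by blast
      ultimately show ?thesis using D(2) by blast
    qed
  qed (fact X Y f act \<K>)+
  then show ?thesis by blast
qed

theorem theorem2:
  fixes X :: "'a uspace" and x0 :: 'a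
    and Y :: "'b uspace" and y0 :: 'b
    and f :: "'a \<Rightarrow> 'b"
  assumes "uspace X" and "x0 \<in> carrier X" and "coverable X x0"
    and "uspace Y" and "y0 \<in> carrier Y" and "coverable Y y0"
    and "ucont X Y f" and "f x0 = y0"
  shows "(\<exists>!F. is_lift X x0 Y y0 f F) \<and>
    (is_cover TYPE('g \<times> 'i \<times> 'p \<times> 'h) X Y f \<longrightarrow>
       uhomeo (univ_space X x0) (univ_space Y y0) (the_lift X x0 Y y0 f)) \<and>
    (\<forall>(Z :: 'c uspace) z0 g.
       uspace Z \<and> z0 \<in> carrier Z \<and> coverable Z z0 \<and> ucont Y Z g \<and> g y0 = z0 \<longrightarrow>
       the_lift X x0 Z z0 (g \<circ> f) =
         compose (carrier (univ_space X x0)) (the_lift Y y0 Z z0 g) (the_lift X x0 Y y0 f))"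
proof (intro conjI impI allI)
  note X = assms(1-3) and Y = assms(4-6) and f = assms(7,8)
  show "\<exists>!F. is_lift X x0 Y y0 f F"
  proof (rule ex1I)
    show lift: "is_lift X x0 Y y0 f (lift_map X x0 Y f)"
      by (rule is_lift_lift_map[OF X(1) Y(1) X(2) f])
    show "F = lift_map X x0 Y f" if "is_lift X x0 Y y0 f F" for F
      by (rule is_lift_unique[OF X Y(1) that lift])
  qed
  show "uhomeo (univ_space X x0) (univ_space Y y0) (the_lift X x0 Y y0 f)"
    if cover: "is_cover TYPE('g \<times> 'i \<times> 'p \<times> 'h) X Y f"
  proof -
    obtain G :: "'g monoid" and act \<K> where "small_kernel_quotient X x0 Y y0 f G act \<K>"
      using cover_small_kernel_quotient[OF X(1,2) Y(1) f cover] by blast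
    then show ?thesis
      unfolding the_lift_lift_map[OF X Y(1) f] by (rule small_kernel_quotient.lift_uhomeo)
  qed
  fix Z :: "'c uspace" and z0 g
  assume Z: "uspace Z \<and> z0 \<in> carrier Z \<and> coverable Z z0 \<and> ucont Y Z g \<and> g y0 = z0"
  then have g: "uspace Z" "ucont Y Z g" "g y0 = z0" by simp_all
  have gf: "ucont X Z (g \<circ> f)" "(g \<circ> f) x0 = z0"
    using ucont_compose[OF f(1) g(2)] f(2) g(3) by simp_all
  show "the_lift X x0 Z z0 (g \<circ> f) =
      compose (carrier (univ_space X x0)) (the_lift Y y0 Z z0 g) (the_lift X x0 Y y0 f)"
    unfolding the_lift_lift_map[OF X g(1) gf] the_lift_lift_map[OF Y g(1-3)] the_lift_lift_map[OF X Y(1) f]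
    by (rule lift_map_compose[OF X(1) Y(1) f g(1,2)])
qed

end
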